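(* Let $S$ and $T$ be two $d$-tuples of bounded commuting operators on Hilbert spaces such that the map defined on $\{p(S): p\in\mathbb{C}[z_1,\dots,z_d]\}$ by $p(S)\mapsto p(T)$ is completely contractive. If $K\subset\mathbb{C}^d$ is polynomially convex and $\sigma_T(S)\subset K$, then $\sigma_T(T)\subset K$.
   Context: $\sigma_T(R)$ denotes the Taylor spectrum of a commuting tuple $R$ of bounded operators (the subscript is part of the notation and unrelated to the tuple $T$). A compact set $K\subset\mathbb{C}^d$ is polynomially convex if it equals its polynomially convex hull $\{z:|p(z)|\le\sup_K|p|\text{ for all polynomials }p\}$. The hypothesis includes that the map is well defined; completely contractive means $\|[p_{ij}(T)]\|\le\|[p_{ij}(S)]\|$ for all square matrices $[p_{ij}]$ of polynomials. *)

theory Defs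
  imports "HOL-Analysis.Analysis" "HOL-Library.Poly_Mapping"
begin

class complex_vector = real_vector +
  fixes scaleC :: "complex \<Rightarrow> 'a \<Rightarrow> 'a"  (infixr "*\<^sub>C" 75)
  assumes scaleC_add_right: "c *\<^sub>C (x + y) = c *\<^sub>C x + c *\<^sub>C y"
    and scaleC_add_left: "(b + c) *\<^sub>C x = b *\<^sub>C x + c *\<^sub>C x"
    and scaleC_scaleC: "b *\<^sub>C c *\<^sub>C x = (b * c) *\<^sub>C x"
    and scaleC_of_real: "of_real r *\<^sub>C x = r *\<^sub>R x"

text \<open>The inner product is linear in its first argument. Positive definiteness is implied by
  the last axiom, since \<^term>\<open>norm\<close> is a norm.\<close>

class complex_inner = complex_vector + real_normed_vector +
  fixes cinner :: "'a \<Rightarrow> 'a \<Rightarrow> complex"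
  assumes cinner_commute: "cinner x y = cnj (cinner y x)"
    and cinner_add_left: "cinner (x + y) z = cinner x z + cinner y z"
    and cinner_scaleC_left: "cinner (c *\<^sub>C x) y = c * cinner x y"
    and norm_eq_sqrt_cinner: "norm x = sqrt (Re (cinner x x))"

class chilbert_space = complex_inner + complete_space

definition bounded_clinear :: "('a::complex_inner \<Rightarrow> 'b::complex_inner) \<Rightarrow> bool" where
  "bounded_clinear A \<longleftrightarrow> bounded_linear A \<and> (\<forall>c x. A (c *\<^sub>C x) = c *\<^sub>C A x)"

text \<open>A \<open>d\<close>-tuple is indexed by a finite linearly ordered type \<open>'d\<close> with \<open>d\<close> elements, playing
  the role of \<open>{1,\<dots>,d}\<close>; the order fixes the signs in the Koszul complex.\<close>

definition commuting_bounded_tuple :: "('d::{finite,linorder} \<Rightarrow> 'a::complex_inner \<Rightarrow> 'a) \<Rightarrow> bool" where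
  "commuting_bounded_tuple T \<longleftrightarrow> (\<forall>i. bounded_clinear (T i)) \<and> (\<forall>i j. T i \<circ> T j = T j \<circ> T i)"

text \<open>Finitely supported coefficient functions on exponent vectors; multiplication in
  \<^theory>\<open>HOL-Library.Poly_Mapping\<close> is the convolution product, that is, the product of polynomials.\<close>

type_synonym 'd cpolynomial = "('d \<Rightarrow>\<^sub>0 nat) \<Rightarrow>\<^sub>0 complex"

definition poly_eval :: "'d::finite cpolynomial \<Rightarrow> complex ^ 'd \<Rightarrow> complex" where
  "poly_eval p z =
    (\<Sum>m\<in>Poly_Mapping.keys p. Poly_Mapping.lookup p m * (\<Prod>i\<in>UNIV. (z $ i) ^ Poly_Mapping.lookup m i))"

text \<open>The factors of a monomial are composed in increasing order of the indices; for commuting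
  tuples the order is immaterial.\<close>

definition monomial_op ::
  "('d \<Rightarrow>\<^sub>0 nat) \<Rightarrow> ('d::{finite,linorder} \<Rightarrow> 'a \<Rightarrow> 'a) \<Rightarrow> 'a \<Rightarrow> 'a" where
  "monomial_op m T =
    foldr (\<lambda>i A. (T i ^^ Poly_Mapping.lookup m i) \<circ> A) (sorted_list_of_set UNIV) id"

definition poly_op ::
  "'d cpolynomial \<Rightarrow> ('d::{finite,linorder} \<Rightarrow> 'a::complex_vector \<Rightarrow> 'a) \<Rightarrow> 'a \<Rightarrow> 'a" where
  "poly_op p T x = (\<Sum>m\<in>Poly_Mapping.keys p. Poly_Mapping.lookup p m *\<^sub>C monomial_op m T x)"

text \<open>Operator norm of the \<open>n \<times> n\<close> operator matrix \<open>[A i j]\<close> acting on the \<open>n\<close>-fold Hilbert space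
  direct sum. Only the components \<open>x i\<close> with \<open>i < n\<close> matter.\<close>

definition op_matrix_norm :: "nat \<Rightarrow> (nat \<Rightarrow> nat \<Rightarrow> 'a::real_normed_vector \<Rightarrow> 'a) \<Rightarrow> real" where
  "op_matrix_norm n A =
    (SUP x\<in>{x. L2_set (\<lambda>i. norm (x i)) {..<n} \<le> 1}.
      L2_set (\<lambda>i. norm (\<Sum>j<n. A i j (x j))) {..<n})"

definition poly_map_completely_contractive ::
  "('d::{finite,linorder} \<Rightarrow> 'a::complex_inner \<Rightarrow> 'a) \<Rightarrow> ('d \<Rightarrow> 'b::complex_inner \<Rightarrow> 'b) \<Rightarrow> bool" where
  "poly_map_completely_contractive S T \<longleftrightarrow>
    (\<forall>p q. poly_op p S = poly_op q S \<longrightarrow> poly_op p T = poly_op q T) \<and>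
    (\<forall>n (P :: nat \<Rightarrow> nat \<Rightarrow> 'd::{finite,linorder} cpolynomial).
      op_matrix_norm n (\<lambda>i j. poly_op (P i j) T) \<le> op_matrix_norm n (\<lambda>i j. poly_op (P i j) S))"

text \<open>The supremum is taken in \<^typ>\<open>ennreal\<close>, so that it is meaningful for every \<open>K\<close>.\<close>

definition polynomially_convex_hull :: "(complex ^ 'd::finite) set \<Rightarrow> (complex ^ 'd) set" where
  "polynomially_convex_hull K =
    {z. \<forall>p. ennreal (cmod (poly_eval p z)) \<le> (SUP w\<in>K. ennreal (cmod (poly_eval p w)))}"

definition polynomially_convex :: "(complex ^ 'd::finite) set \<Rightarrow> bool" where
  "polynomially_convex K \<longleftrightarrow> compact K \<and> K = polynomially_convex_hull K"

text \<open>An element \<open>\<Sum>\<^sub>I \<omega>(I) \<otimes> e\<^sub>I\<close> of \<open>H \<otimes> \<Lambda>\<^sup>k(\<complex>\<^sup>d)\<close>, with \<open>I\<close> ranging over the \<open>k\<close>-element subsets of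
  the index type and \<open>e\<^sub>I\<close> the wedge product of the \<open>e\<^sub>i\<close>, \<open>i \<in> I\<close>, in increasing order, is represented
  by its family of coefficients \<open>\<omega>\<close>.\<close>

definition koszul_space :: "nat \<Rightarrow> ('d::finite set \<Rightarrow> 'a::zero) set" where
  "koszul_space k = {\<omega>. \<forall>I. card I \<noteq> k \<longrightarrow> \<omega> I = 0}"

text \<open>The differential \<open>x \<otimes> e\<^sub>I \<mapsto> \<Sum>\<^sub>i T\<^sub>i x \<otimes> (e\<^sub>i \<and> e\<^sub>I)\<close> in coefficients: moving \<open>e\<^sub>i\<close> to its place in
  \<open>e\<^sub>J\<close>, \<open>J = I \<union> {i}\<close>, produces one sign for each \<open>j \<in> J\<close> with \<open>j < i\<close>.\<close>

definition koszul_diff ::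
  "('d::{finite,linorder} \<Rightarrow> 'a::real_vector \<Rightarrow> 'a) \<Rightarrow> ('d set \<Rightarrow> 'a) \<Rightarrow> ('d set \<Rightarrow> 'a)" where
  "koszul_diff T \<omega> J = (\<Sum>i\<in>J. (- 1) ^ card {j\<in>J. j < i} *\<^sub>R T i (\<omega> (J - {i})))"

definition koszul_exact :: "('d::{finite,linorder} \<Rightarrow> 'a::real_vector \<Rightarrow> 'a) \<Rightarrow> bool" where
  "koszul_exact T \<longleftrightarrow>
    (\<forall>k. {\<omega> \<in> koszul_space k. koszul_diff T \<omega> = (\<lambda>_. 0)} =
      (case k of 0 \<Rightarrow> {\<lambda>_. 0} | Suc l \<Rightarrow> koszul_diff T ` koszul_space l))"

definition taylor_spectrum ::
  "('d::{finite,linorder} \<Rightarrow> 'a::complex_inner \<Rightarrow> 'a) \<Rightarrow> (complex ^ 'd::{finite,linorder}) set" where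
  "taylor_spectrum T = {z. \<not> koszul_exact (\<lambda>i x. T i x - (z $ i) *\<^sub>C x)}"

end

theory Submission
  imports Defs
begin

text \<open>Suppose that \<open>l\<close> lies outside \<open>K\<close>. Polynomial convexity gives a polynomial \<open>p\<close> with \<open>p(l) = 1\<close> and
  \<open>|p| < 1\<close> on \<open>K\<close>, hence on the Taylor spectrum of \<open>S\<close>. The spectral radius of \<open>p(S)\<close> is attained on the
  joint approximate point spectrum of \<open>S\<close>, which lies in the Taylor spectrum: if the Koszul complex is exact
  in degrees 0 and 1, then \<open>x \<mapsto> (S\<^sub>i x - l\<^sub>i x)\<^sub>i\<close> is injective with closed range, hence bounded below. So
  \<open>\<parallel>p(T)\<^sup>n\<parallel> \<le> \<parallel>p(S)\<^sup>n\<parallel> < 1\<close> for some \<open>n\<close>. Writing \<open>1 - p\<^sup>n\<close> as a combination of the \<open>X\<^sub>i - l\<^sub>i\<close> presents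
  the invertible operator \<open>1 - p(T)\<^sup>n\<close> as null-homotopic on the Koszul complex of \<open>T - l\<close>, which is
  therefore exact.

  For the spectral radius, polynomials carry the seminorm \<open>N(p) = \<parallel>p(S)\<parallel>\<close>. A joint topological divisor of
  zero for \<open>N\<close> yields joint approximate eigenvectors of \<open>S\<close>, and a finite family of such divisors is enlarged
  by one element at a time after passing to a seminorm that vanishes on the family.\<close>

section \<open>Roots of unity\<close>

text \<open>Both sides have degree at most \<open>n\<close> and agree at the \<open>n + 1\<close>
  points consisting of 0 and the \<open>n\<close>-th roots of unity; the inverse of a root of unity
  is again one, so a factor vanishes there.\<close>

lemma prod_one_minus_root_of_unity_poly:
  assumes n: "n > 0"
  shows "(\<Prod>w | w ^ n = 1. [:1, - w:]) = 1 - monom (1::complex) n"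
proof (rule poly_eqI_degree)
  let ?U = "{w :: complex. w ^ n = 1}"
  have fin: "finite ?U" using n by (simp add: finite_roots_unity)
  have card: "card ?U = n" using n by (simp add: card_roots_unity_eq)
  have z: "0 \<notin> ?U" using n by (simp add: zero_power)
  show "poly (\<Prod>w\<in>?U. [:1, - w:]) x = poly (1 - monom 1 n) x" if "x \<in> insert 0 ?U" for x
  proof (cases "x = 0")
    case True
    then show ?thesis using n by (simp add: poly_prod poly_monom)
  next
    case False
    then have "x ^ n = 1" using that by auto
    then have "inverse x \<in> ?U" by (simp add: power_inverse)
    then have "(\<Prod>w\<in>?U. 1 - x * w) = 0" using fin False by (intro prod_zero) auto
    then show ?thesis using \<open>x ^ n = 1\<close> by (simp add: poly_prod poly_monom)
  qed
  have "degree (\<Prod>w\<in>?U. [:1, - w:]) \<le> (\<Sum>w\<in>?U. 1)"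
    by (rule order.trans[OF degree_prod_sum_le[OF fin] sum_mono]) (auto simp: degree_pCons_eq_if)
  then show "card (insert 0 ?U) > degree (\<Prod>w\<in>?U. [:1, - w:])"
    using fin z card by simp
  have "degree (1 - monom (1::complex) n) \<le> n"
    by (rule degree_diff_le) (auto simp: degree_monom_le)
  then show "card (insert 0 ?U) > degree (1 - monom (1::complex) n)"
    using fin z card by simp
qed

text \<open>Logarithmic differentiation of \<open>\<Prod>(1 - w X) = 1 - X^n\<close>.\<close>

lemma sum_prod_one_minus_root_of_unity_poly:
  assumes n: "n > 0"
  shows "(\<Sum>w | w ^ n = 1. \<Prod>v\<in>{v. v ^ n = 1} - {w}. [:1, - v:]) = [:of_nat n :: complex:]"
proof -
  let ?U = "{w :: complex. w ^ n = 1}"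
  let ?P = "\<lambda>w. \<Prod>v\<in>?U - {w}. [:1, - v:]"
  let ?X = "[:0, 1 :: complex:]"
  have fin: "finite ?U" using n by (simp add: finite_roots_unity)
  have card: "card ?U = n" using n by (simp add: card_roots_unity_eq)
  have split: "[:1, - w:] * ?P w = 1 - monom 1 n" if "w \<in> ?U" for w
    using prod.remove[OF fin that, of "\<lambda>v. [:1, - v:]"] prod_one_minus_root_of_unity_poly[OF n] by simp
  have "pderiv (1 - monom (1::complex) n) = (\<Sum>w\<in>?U. ?P w * [:- w:])"
    unfolding prod_one_minus_root_of_unity_poly[OF n, symmetric]
    by (subst pderiv_prod) (simp add: pderiv_pCons)
  then have "(\<Sum>w\<in>?U. ?P w * [:- w:]) = - monom (of_nat n) (n - 1)"
    by (simp add: pderiv_diff pderiv_monom)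
  then have "?X * (\<Sum>w\<in>?U. ?P w * [:- w:]) = - monom (of_nat n) n"
    using n by (simp add: flip: monom_Suc)
  \<comment> \<open>Each factor is split as \<open>1 - w X = 1 + X (- w)\<close>: multiplying the
    cofactor of \<open>w\<close> by it gives the cofactor itself plus \<open>X\<close> times a
    summand of the derivative.\<close>
  moreover have "(\<Sum>w\<in>?U. ?P w) + ?X * (\<Sum>w\<in>?U. ?P w * [:- w:]) = (\<Sum>w\<in>?U. [:1, - w:] * ?P w)"
    unfolding sum_distrib_left sum.distrib[symmetric]
  proof (rule sum.cong[OF refl])
    fix w
    have "[:1, - w:] = 1 + ?X * [:- w:]" by (simp add: one_pCons)
    then show "?P w + ?X * (?P w * [:- w:]) = [:1, - w:] * ?P w"
      by (simp only: ring_distribs mult_ac mult_1_left)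
  qed
  moreover have "(\<Sum>w\<in>?U. [:1, - w:] * ?P w) = of_nat n * (1 - monom 1 n)"
    using split card by simp
  ultimately show ?thesis
    by (simp add: algebra_simps of_nat_poly smult_monom)
qed

text \<open>A commutative complex algebra, given by the embedding \<open>h\<close> of the scalars.
  The instance of interest is the polynomial ring with its constant polynomials.\<close>

locale complex_algebra_map =
  fixes h :: "complex \<Rightarrow> 'r::comm_ring_1"
  assumes h_add: "h (a + b) = h a + h b"
    and h_mult: "h (a * b) = h a * h b"
    and h_1 [simp]: "h 1 = 1"
begin

lemma h_0 [simp]: "h 0 = 0"
  using h_add[of 0 0] by simp

lemma h_minus: "h (- a) = - h a"
  using h_add[of a "- a"] by (simp add: eq_neg_iff_add_eq_0 add.commute)

lemma h_diff: "h (a - b) = h a - h b"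
  using h_add[of a "- b"] by (simp add: h_minus)

lemma h_sum: "h (sum f I) = (\<Sum>i\<in>I. h (f i))"
  by (induction I rule: infinite_finite_induct) (auto simp: h_add)

lemma h_of_nat: "h (of_nat n) = of_nat n"
  by (induction n) (auto simp: h_add)

text \<open>Evaluation at a ring element along \<open>h\<close>; it transports the identities over
  the roots of unity from \<open>complex poly\<close> to the algebra.\<close>

definition scalar_poly :: "complex poly \<Rightarrow> 'r \<Rightarrow> 'r" where
  "scalar_poly p x = poly (map_poly h p) x"

lemma scalar_poly_add: "scalar_poly (p + q) x = scalar_poly p x + scalar_poly q x"
proof -
  have "map_poly h (p + q) = map_poly h p + map_poly h q"
    by (rule poly_eqI) (simp add: coeff_map_poly h_add)
  then show ?thesis by (simp add: scalar_poly_def)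
qed

lemma scalar_poly_mult: "scalar_poly (p * q) x = scalar_poly p x * scalar_poly q x"
proof -
  have "map_poly h (p * q) = map_poly h p * map_poly h q"
    by (rule poly_eqI) (simp add: coeff_map_poly coeff_mult h_sum h_mult)
  then show ?thesis by (simp add: scalar_poly_def)
qed

lemma scalar_poly_pCons: "scalar_poly (pCons a p) x = h a + x * scalar_poly p x"
  unfolding scalar_poly_def by (cases "p = 0 \<and> a = 0") (auto simp: map_poly_pCons)

lemma scalar_poly_0 [simp]: "scalar_poly 0 x = 0"
  by (simp add: scalar_poly_def)

lemma scalar_poly_1 [simp]: "scalar_poly 1 x = 1"
  by (simp add: one_pCons scalar_poly_pCons)

lemma scalar_poly_monom: "scalar_poly (monom a n) x = h a * x ^ n"
  by (induction n) (simp_all add: monom_0 monom_Suc scalar_poly_pCons algebra_simps)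

lemma scalar_poly_sum: "scalar_poly (sum f I) x = (\<Sum>i\<in>I. scalar_poly (f i) x)"
  by (induction I rule: infinite_finite_induct) (auto simp: scalar_poly_add)

lemma scalar_poly_prod: "scalar_poly (prod f I) x = (\<Prod>i\<in>I. scalar_poly (f i) x)"
  by (induction I rule: infinite_finite_induct) (auto simp: scalar_poly_mult)

lemma scalar_poly_diff: "scalar_poly (p - q) x = scalar_poly p x - scalar_poly q x"
  using scalar_poly_add[of "p - q" q x] by simp

lemma scalar_poly_linear: "scalar_poly [:1, - v:] x = 1 - h v * x"
  by (simp add: scalar_poly_pCons h_minus algebra_simps)

lemma prod_one_minus_root_of_unity:
  "n > 0 \<Longrightarrow> (\<Prod>w | w ^ n = 1. 1 - h w * x) = 1 - x ^ n"
  using arg_cong[OF prod_one_minus_root_of_unity_poly, of n "\<lambda>p. scalar_poly p x"]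
  by (simp add: scalar_poly_prod scalar_poly_diff scalar_poly_monom scalar_poly_linear)

lemma sum_prod_one_minus_root_of_unity:
  "n > 0 \<Longrightarrow> (\<Sum>w | w ^ n = 1. \<Prod>v\<in>{v. v ^ n = 1} - {w}. 1 - h v * x) = of_nat n"
  using arg_cong[OF sum_prod_one_minus_root_of_unity_poly, of n "\<lambda>p. scalar_poly p x"]
  by (simp add: scalar_poly_prod scalar_poly_sum scalar_poly_linear) (simp add: scalar_poly_pCons h_of_nat)

end

section \<open>Topological divisors of zero in seminormed algebras\<close>

text \<open>\<open>N\<close> is only a seminorm: \<open>p(S)\<close> may be 0 for a nonzero
  polynomial \<open>p\<close>, and \<open>null_seminorm\<close> below vanishes on a whole family.
  Equality in the scaling law follows by applying the inequality to the inverse scalar.\<close>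

locale complex_seminormed_algebra = complex_algebra_map h
  for h :: "complex \<Rightarrow> 'r::comm_ring_1" +
  fixes N :: "'r \<Rightarrow> real"
  assumes N_add: "N (a + b) \<le> N a + N b"
    and N_mult: "N (a * b) \<le> N a * N b"
    and N_scale_le: "N (h c * a) \<le> cmod c * N a"
    and N_1 [simp]: "N 1 = 1"
begin

lemma N_0 [simp]: "N 0 = 0"
  using N_scale_le[of 0 1] N_add[of 0 0] by simp

lemma N_minus [simp]: "N (- a) = N a"
proof -
  have "N (- b) \<le> N b" for b
    using N_scale_le[of "- 1" b] by (simp add: h_minus)
  from this[of a] this[of "- a"] show ?thesis by simp
qed

lemma N_nonneg [simp]: "0 \<le> N a"
  using N_add[of a "- a"] by simp

lemma N_scale: "N (h c * a) = cmod c * N a"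
proof (cases "c = 0")
  case False
  have "a = h (inverse c) * (h c * a)"
    using False by (simp flip: mult.assoc h_mult)
  then have "N a \<le> cmod (inverse c) * N (h c * a)"
    using N_scale_le[of "inverse c" "h c * a"] by simp
  then have "cmod c * N a \<le> cmod c * (cmod (inverse c) * N (h c * a))"
    by (intro mult_left_mono) auto
  also have "\<dots> = N (h c * a)"
    using False by (simp only: norm_inverse) simp
  finally have "cmod c * N a \<le> N (h c * a)" .
  then show ?thesis using N_scale_le[of c a] by simp
qed simp

lemma N_diff: "N (a - b) \<le> N a + N b"
  using N_add[of a "- b"] by simp

lemma N_sum: "N (sum f I) \<le> (\<Sum>i\<in>I. N (f i))"
  by (induction I rule: infinite_finite_induct) (auto intro: order.trans[OF N_add])

lemma N_power: "N (a ^ n) \<le> N a ^ n"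
proof (induction n)
  case (Suc n)
  have "N (a * a ^ n) \<le> N a * N (a ^ n)" by (rule N_mult)
  also have "\<dots> \<le> N a * N a ^ n" using Suc by (intro mult_left_mono) auto
  finally show ?case by simp
qed simp

text \<open>The members of \<open>B\<close> are joint topological divisors of zero.\<close>

definition approx_null :: "'r set \<Rightarrow> bool" where
  "approx_null B \<longleftrightarrow> (\<forall>e>0. \<exists>b. N b = 1 \<and> (\<forall>f\<in>B. N (f * b) \<le> e))"

text \<open>Multiplication by the scalar \<open>1 / N b\<close> normalises the witness.\<close>

lemma approx_nullI:
  assumes "\<And>e. e > 0 \<Longrightarrow> \<exists>b. N b > 0 \<and> (\<forall>f\<in>B. N (f * b) \<le> e * N b)"
  shows "approx_null B"
  unfolding approx_null_def
proof (intro allI impI)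
  fix e :: real assume "e > 0"
  then obtain b where b: "N b > 0" "\<And>f. f \<in> B \<Longrightarrow> N (f * b) \<le> e * N b"
    using assms by blast
  let ?b = "h (of_real (inverse (N b))) * b"
  have "N (f * ?b) \<le> e" if "f \<in> B" for f
  proof -
    have "f * ?b = h (of_real (inverse (N b))) * (f * b)" by (simp add: mult_ac)
    then have "N (f * ?b) = inverse (N b) * N (f * b)"
      using b(1) by (simp only: N_scale norm_of_real) simp
    also have "\<dots> \<le> inverse (N b) * (e * N b)"
      using b(1) b(2)[OF that] by (intro mult_left_mono) auto
    also have "\<dots> = e" using b(1) by simp
    finally show ?thesis .
  qed
  moreover have "N ?b = 1" using b(1) by (simp only: N_scale norm_of_real) simp
  ultimately show "\<exists>b. N b = 1 \<and> (\<forall>f\<in>B. N (f * b) \<le> e)" by blast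
qed

section \<open>From lower bounds on resolvent factors to powers of small seminorm\<close>

lemma not_approx_null_singletonD:
  assumes "\<not> approx_null {d}"
  obtains \<delta> where "\<delta> > 0" "\<And>a. \<delta> * N a \<le> N (d * a)"
proof -
  obtain e where "e > 0" "\<And>b. N b > 0 \<Longrightarrow> \<not> N (d * b) \<le> e * N b"
    using assms approx_nullI[of "{d}"] by auto
  then have "e * N a \<le> N (d * a)" for a
    by (cases "N a > 0") (use N_nonneg[of a] in force)+
  with \<open>e > 0\<close> show ?thesis using that by blast
qed

text \<open>For \<open>z \<noteq> 0\<close> in the disc, \<open>1 - z C = - z (C - 1/z)\<close> with
  \<open>|1/z| \<ge> 1\<close>, so each \<open>z\<close> has its own lower bound. Moving
  \<open>z\<close> changes the bound by at most the distance times \<open>N C\<close>, and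
  compactness of the closed disc makes it uniform.\<close>

lemma resolvent_bound_uniform:
  assumes C: "\<And>c. cmod c \<ge> 1 \<Longrightarrow> \<not> approx_null {C - h c}"
  obtains \<delta> where "\<delta> > 0" "\<And>z a. cmod z \<le> 1 \<Longrightarrow> \<delta> * N a \<le> N ((1 - h z * C) * a)"
proof -
  define L where "L = N C + 1"
  have L: "L > 0" unfolding L_def using N_nonneg[of C] by linarith
  have pointwise: "\<exists>\<delta>>0. \<forall>a. \<delta> * N a \<le> N ((1 - h z * C) * a)" if "cmod z \<le> 1" for z
  proof (cases "z = 0")
    case True
    then show ?thesis by (auto intro!: exI[of _ 1])
  next
    case False
    then have "cmod (1 / z) \<ge> 1" using that by (simp add: norm_divide)
    then obtain \<delta> where \<delta>: "\<delta> > 0" "\<And>a. \<delta> * N a \<le> N ((C - h (1 / z)) * a)"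
      using not_approx_null_singletonD[OF C] by blast
    have "1 - h z * C = h (- z) * (C - h (1 / z))"
      using False by (simp add: right_diff_distrib h_minus flip: h_mult)
    then have "(1 - h z * C) * a = h (- z) * ((C - h (1 / z)) * a)" for a
      by (simp add: mult.assoc)
    then have "cmod z * \<delta> * N a \<le> N ((1 - h z * C) * a)" for a
      using \<delta>(2)[of a] by (simp only: N_scale) (simp add: mult.assoc mult_left_mono)
    then show ?thesis using \<delta>(1) False by (intro exI[of _ "cmod z * \<delta>"]) auto
  qed
  then obtain \<delta> where \<delta>: "\<And>z. cmod z \<le> 1 \<Longrightarrow> \<delta> z > 0"
    "\<And>z a. cmod z \<le> 1 \<Longrightarrow> \<delta> z * N a \<le> N ((1 - h z * C) * a)"
    by metis
  \<comment> \<open>The radii are chosen so that passing from a centre \<open>z\<close> to a point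
    of its ball costs at most half of the lower bound at \<open>z\<close>.\<close>
  obtain F where F: "F \<subseteq> cball 0 1" "finite F" "cball 0 1 \<subseteq> (\<Union>z\<in>F. ball z (\<delta> z / (2 * L)))"
  proof (rule compactE_image[OF compact_cball[of "0::complex" 1], of "cball 0 1" "\<lambda>z. ball z (\<delta> z / (2 * L))"])
    show "cball 0 1 \<subseteq> (\<Union>z\<in>cball 0 1. ball z (\<delta> z / (2 * L)))"
      using \<delta>(1) L by force
  qed auto
  define \<delta>' where "\<delta>' = Min ((\<lambda>z. \<delta> z / 2) ` F)"
  have "F \<noteq> {}" using F(3) by force
  then have "\<delta>' > 0" using F \<delta>(1) by (auto simp: \<delta>'_def)
  moreover have "\<delta>' * N a \<le> N ((1 - h z * C) * a)" if z: "cmod z \<le> 1" for z a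
  proof -
    from z F(3) obtain w where w: "w \<in> F" "cmod (w - z) < \<delta> w / (2 * L)"
      by (force simp: dist_norm)
    have "cmod w \<le> 1" using w(1) F(1) by auto
    have "(1 - h w * C) * a = (1 - h z * C) * a + h (z - w) * (C * a)"
      by (simp add: h_diff algebra_simps)
    then have "N ((1 - h w * C) * a) \<le> N ((1 - h z * C) * a) + cmod (z - w) * N (C * a)"
      by (metis N_add N_scale)
    also have "cmod (z - w) * N (C * a) \<le> \<delta> w / (2 * L) * (L * N a)"
    proof (rule mult_mono)
      show "N (C * a) \<le> L * N a"
        unfolding L_def distrib_right mult_1_left using N_mult[of C a] N_nonneg[of a] by linarith
    qed (use w \<delta>(1)[OF \<open>cmod w \<le> 1\<close>] L in \<open>auto simp: norm_minus_commute\<close>)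
    also have "\<dots> = \<delta> w / 2 * N a" using L by simp
    finally have "\<delta> w / 2 * N a \<le> N ((1 - h z * C) * a)"
      using \<delta>(2)[OF \<open>cmod w \<le> 1\<close>, of a] by (simp add: algebra_simps)
    moreover have "\<delta>' * N a \<le> \<delta> w / 2 * N a"
      unfolding \<delta>'_def using F w by (intro mult_right_mono Min_le) auto
    ultimately show ?thesis by simp
  qed
  ultimately show ?thesis using that by blast
qed

text \<open>With \<open>X = (s C)^n\<close> and \<open>Y = (t C)^n\<close>, this is the formula
  \<open>1/(1 - X) = (1/n) sum_w 1/(1 - w s C)\<close> over the \<open>n\<close>-th roots of unity,
  combined with the resolvent identity for each \<open>w\<close> and multiplied by
  \<open>(1 - X) (1 - Y)\<close>. The factor in front does not depend on \<open>n\<close>.\<close>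

lemma power_perturbation:
  assumes \<delta>: "\<delta> > 0" "\<And>z a. cmod z \<le> 1 \<Longrightarrow> \<delta> * N a \<le> N ((1 - h z * C) * a)"
    and st: "cmod s \<le> 1" "cmod t \<le> 1" and n: "n > 0"
  shows "N ((h s * C) ^ n - (h t * C) ^ n) \<le>
    cmod (s - t) * N C / \<delta>\<^sup>2 * (N (1 - (h s * C) ^ n) * N (1 - (h t * C) ^ n))"
proof -
  let ?U = "{w :: complex. w ^ n = 1}"
  define D where "D = (\<lambda>r w. 1 - h w * (h r * C))"
  define P where "P = (\<lambda>r w. \<Prod>v\<in>?U - {w}. D r v)"
  define G where "G = (\<lambda>r. 1 - (h r * C) ^ n)"
  have fin: "finite ?U" using n by (simp add: finite_roots_unity)
  have card: "card ?U = n" using n by (simp add: card_roots_unity_eq)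
  have DP: "G r = D r w * P r w" if "w \<in> ?U" for r w
    using prod.remove[OF fin that, of "D r"] prod_one_minus_root_of_unity[OF n, of "h r * C"]
    by (simp add: D_def P_def G_def)
  have sumP: "(\<Sum>w\<in>?U. P r w) = of_nat n" for r
    using sum_prod_one_minus_root_of_unity[OF n, of "h r * C"] by (simp add: D_def P_def)
  have norm_1: "cmod w = 1" if "w \<in> ?U" for w
    using that n by (intro power_eq_imp_eq_base[of "cmod w" n 1]) (auto simp flip: norm_power)
  have lower: "\<delta> * N a \<le> N (D r w * a)" if "w \<in> ?U" "cmod r \<le> 1" for r w a
  proof -
    have "D r w = 1 - h (w * r) * C" by (simp add: D_def h_mult mult.assoc)
    then show ?thesis using \<delta>(2)[of "w * r" a] that norm_1 by (simp add: norm_mult)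
  qed
  text \<open>\<open>D r w\<close> and its cofactor \<open>P r w\<close> replace the resolvent identity, so that no inverses occur.\<close>
  define b where "b = cmod (s - t) * N C / \<delta>\<^sup>2 * (N (G s) * N (G t))"
  have diff_le: "N (P s w * G t - P t w * G s) \<le> b" if w: "w \<in> ?U" for w
  proof -
    have "P s w * G t - P t w * G s = P s w * P t w * (D t w - D s w)"
      unfolding DP[OF w] by (simp add: algebra_simps)
    also have "D t w - D s w = h (w * (s - t)) * C"
      by (simp add: D_def h_mult h_diff algebra_simps)
    also have "P s w * P t w * (h (w * (s - t)) * C) = h (w * (s - t)) * (P s w * P t w * C)"
      by (simp add: mult_ac)
    finally have "N (P s w * G t - P t w * G s) = cmod (s - t) * N (P s w * P t w * C)"
      by (simp add: N_scale norm_mult norm_1[OF w])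
    also have "\<dots> \<le> cmod (s - t) * (N (P s w * P t w) * N C)"
      by (intro mult_left_mono N_mult) auto
    \<comment> \<open>Multiplying by \<open>D s w\<close> and then by \<open>D t w\<close> restores
      \<open>G s * G t\<close>; each multiplication loses at most a factor
      \<open>\<delta>\<close>.\<close>
    also have "N (P s w * P t w) \<le> N (G s) * N (G t) / \<delta>\<^sup>2"
    proof -
      have "\<delta> * (\<delta> * N (P s w * P t w)) \<le> \<delta> * N (D s w * (P s w * P t w))"
        using \<delta>(1) lower[OF w st(1)] by (intro mult_left_mono) auto
      also have "\<dots> \<le> N (D t w * (D s w * (P s w * P t w)))"
        using lower[OF w st(2)] .
      also have "D t w * (D s w * (P s w * P t w)) = G s * G t"
        unfolding DP[OF w] by (simp add: mult_ac)
      also have "N (G s * G t) \<le> N (G s) * N (G t)" by (rule N_mult)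
      finally show ?thesis using \<delta>(1) by (simp add: field_simps power2_eq_square)
    qed
    finally have "N (P s w * G t - P t w * G s) \<le> cmod (s - t) * (N (G s) * N (G t) / \<delta>\<^sup>2 * N C)"
      by (simp add: mult_left_mono mult_right_mono)
    also have "\<dots> = b" by (simp add: b_def)
    finally show ?thesis .
  qed
  \<comment> \<open>The cofactors sum to \<open>n\<close>, and there are \<open>n\<close> summands
    bounded by \<open>b\<close>, so the factor \<open>n\<close> cancels.\<close>
  have "of_nat n * (G t - G s) = (\<Sum>w\<in>?U. P s w * G t - P t w * G s)"
    by (simp add: sum_subtractf sumP right_diff_distrib flip: sum_distrib_right)
  then have "N (of_nat n * (G t - G s)) \<le> (\<Sum>w\<in>?U. b)"
    by (simp only: order.trans[OF N_sum sum_mono[OF diff_le]])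
  moreover have "N (of_nat n * (G t - G s)) = n * N (G t - G s)"
    using N_scale[of "of_nat n" "G t - G s"] by (simp add: h_of_nat)
  ultimately have "N (G t - G s) \<le> b" using n by (simp add: card)
  then show ?thesis by (simp add: b_def G_def)
qed

text \<open>The property that some power of \<open>t C\<close> has seminorm below 1 propagates from \<open>t = 0\<close> to \<open>t = 1\<close> in
  steps of a fixed size.\<close>

lemma ex_power_less_1:
  assumes C: "\<And>c. cmod c \<ge> 1 \<Longrightarrow> \<not> approx_null {C - h c}"
  shows "\<exists>n>0. N (C ^ n) < 1"
proof -
  obtain \<delta> where \<delta>: "\<delta> > 0" "\<And>z a. cmod z \<le> 1 \<Longrightarrow> \<delta> * N a \<le> N ((1 - h z * C) * a)"
    using resolvent_bound_uniform[OF C] by blast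
  have step: "\<exists>n>0. N ((h s * C) ^ n) < 1"
    if "\<exists>n>0. N ((h t * C) ^ n) < 1" and st: "cmod s \<le> 1" "cmod t \<le> 1"
      and close: "cmod (s - t) * N C / \<delta>\<^sup>2 \<le> 1 / 8" for s t
  proof -
    from that obtain n where n: "n > 0" "N ((h t * C) ^ n) < 1" by blast
    \<comment> \<open>Raising to a further power brings the seminorm below 1/8. Using
      \<open>Suc k\<close> keeps the total exponent \<open>m\<close> positive.\<close>
    obtain k where "N ((h t * C) ^ n) ^ k < 1 / 8"
      using real_arch_pow_inv[of "1 / 8" "N ((h t * C) ^ n)"] n by auto
    then have k: "N ((h t * C) ^ n) ^ Suc k < 1 / 8"
      using n mult_left_le_one_le[of "N ((h t * C) ^ n) ^ k" "N ((h t * C) ^ n)"] by simp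
    define m where "m = n * Suc k"
    define X where "X = (h s * C) ^ m"
    define Y where "Y = (h t * C) ^ m"
    have "m > 0" using n by (simp add: m_def)
    have Y: "N Y \<le> 1 / 8"
      using N_power[of "(h t * C) ^ n" "Suc k"] k unfolding Y_def m_def power_mult by linarith
    have "N (X - Y) \<le> cmod (s - t) * N C / \<delta>\<^sup>2 * (N (1 - X) * N (1 - Y))"
      unfolding X_def Y_def by (rule power_perturbation[OF \<delta> st \<open>m > 0\<close>])
    also have "\<dots> \<le> 1 / 8 * ((1 + N X) * (9 / 8))"
      using close N_diff[of 1 X] N_diff[of 1 Y] Y by (intro mult_mono) auto
    \<comment> \<open>With \<open>x = N X\<close> the estimates give
      \<open>x \<le> 9/64 (1 + x) + 1/8\<close>, that is, \<open>x \<le> 17/55\<close>.\<close>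
    finally have "N X < 1"
      using N_add[of "X - Y" Y] Y by simp
    then show ?thesis using \<open>m > 0\<close> by (auto simp: X_def)
  qed
  \<comment> \<open>The segment from 0 to 1 is divided into \<open>K\<close> steps of length
    \<open>1/K\<close>, each short enough for \<open>step\<close>.\<close>
  obtain K :: nat where K: "8 * N C / \<delta>\<^sup>2 < K" using reals_Archimedean2 by blast
  moreover have "0 \<le> 8 * N C / \<delta>\<^sup>2" by simp
  ultimately have K_pos: "K > 0" by (cases K) auto
  have "i \<le> K \<Longrightarrow> \<exists>n>0. N ((h (of_nat i / of_nat K) * C) ^ n) < 1" for i
  proof (induction i)
    case 0
    then show ?case by (auto intro!: exI[of _ 1])
  next
    case (Suc i)
    show ?case
    proof (rule step)
      show "\<exists>n>0. N ((h (of_nat i / of_nat K) * C) ^ n) < 1" using Suc by simp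
      have "(of_nat (Suc i) / of_nat K - of_nat i / of_nat K :: complex) = 1 / of_nat K"
        by (simp add: add_divide_distrib)
      then show "cmod (of_nat (Suc i) / of_nat K - of_nat i / of_nat K) * N C / \<delta>\<^sup>2 \<le> 1 / 8"
        using K K_pos \<delta>(1) by (simp add: norm_divide field_simps)
    qed (use Suc K_pos in \<open>auto simp: norm_divide simp flip: of_nat_Suc\<close>)
  qed
  from this[of K] show ?thesis using K_pos by simp
qed

text \<open>The counterpart of nonempty spectrum. If no \<open>C - c\<close> were a topological
  divisor of zero, the case \<open>c = 0\<close> would bound \<open>C\<close> below; a suitable
  multiple of \<open>C\<close> would then have all powers of seminorm at least 1, while
  \<open>ex_power_less_1\<close> applies to every multiple.\<close>

lemma ex_approx_null: "\<exists>c. approx_null {C - h c}"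
proof (rule ccontr)
  assume *: "\<nexists>c. approx_null {C - h c}"
  then obtain \<delta> where \<delta>: "\<delta> > 0" "\<And>a. \<delta> * N a \<le> N (C * a)"
    using not_approx_null_singletonD[of C] by (metis diff_zero h_0)
  define s :: complex where "s = of_real (1 / \<delta>)"
  have s: "s \<noteq> 0" using \<delta>(1) by (simp add: s_def)
  have low: "1 \<le> N ((h s * C) ^ n)" for n
  proof (induction n)
    case (Suc n)
    have "(h s * C) ^ Suc n = h s * (C * (h s * C) ^ n)" by (simp add: mult_ac)
    then have "N ((h s * C) ^ Suc n) = N (C * (h s * C) ^ n) / \<delta>"
      using \<delta>(1) by (simp only: N_scale s_def) (simp add: norm_divide)
    then show ?case using Suc \<delta>(2)[of "(h s * C) ^ n"] \<delta>(1)
      by (simp add: field_simps) (smt (verit) mult_le_cancel_left1 mult.commute)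
  qed simp
  have "\<not> approx_null {h s * C - h c}" for c
  proof
    assume a: "approx_null {h s * C - h c}"
    have eq: "C - h (c / s) = h (1 / s) * (h s * C - h c)"
      using s by (simp add: right_diff_distrib flip: mult.assoc h_mult)
    have "approx_null {C - h (c / s)}"
      unfolding approx_null_def
    proof (intro allI impI)
      fix e :: real assume "e > 0"
      then have "e * cmod s > 0" using s by simp
      then obtain b where b: "N b = 1" "N ((h s * C - h c) * b) \<le> e * cmod s"
        using a unfolding approx_null_def by blast
      have "N ((C - h (c / s)) * b) \<le> e"
        using b(2) s unfolding eq mult.assoc N_scale by (simp add: norm_divide field_simps)
      with b(1) show "\<exists>b. N b = 1 \<and> (\<forall>f\<in>{C - h (c / s)}. N (f * b) \<le> e)" by auto
    qed
    with * show False by blast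
  qed
  then obtain n where "N ((h s * C) ^ n) < 1" using ex_power_less_1[of "h s * C"] by blast
  with low[of n] show False by simp
qed

text \<open>The seminorm induced by \<open>N\<close> on the vectors that are asymptotically annihilated by \<open>B\<close>.\<close>

definition null_bound :: "'r set \<Rightarrow> 'r \<Rightarrow> real \<Rightarrow> bool" where
  "null_bound B a t \<longleftrightarrow> 0 \<le> t \<and> (\<exists>M\<ge>0. \<forall>x. N (a * x) \<le> t * N x + M * (\<Sum>f\<in>B. N (f * x)))"

definition null_seminorm :: "'r set \<Rightarrow> 'r \<Rightarrow> real" where
  "null_seminorm B a = Inf {t. null_bound B a t}"

lemma sum_N_nonneg: "0 \<le> (\<Sum>f\<in>B. N (f * x))"
  by (simp add: sum_nonneg)

lemma null_bound_N: "null_bound B a (N a)"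
  unfolding null_bound_def
  by (intro conjI N_nonneg exI[of _ "0::real"] order.refl allI) (simp add: N_mult)

lemma null_seminorm_le: "null_bound B a t \<Longrightarrow> null_seminorm B a \<le> t"
  unfolding null_seminorm_def
  by (rule cInf_lower) (auto intro!: bdd_belowI[of _ 0] simp: null_bound_def)

lemma null_bound_of_less:
  assumes "null_seminorm B a < t"
  shows "null_bound B a t"
proof -
  obtain s where s: "null_bound B a s" "s < t"
    using assms cInf_lessD[of "{t. null_bound B a t}" t] null_bound_N
    unfolding null_seminorm_def by blast
  then obtain M where M: "M \<ge> 0" "\<And>x. N (a * x) \<le> s * N x + M * (\<Sum>f\<in>B. N (f * x))"
    by (auto simp: null_bound_def)
  have "N (a * x) \<le> t * N x + M * (\<Sum>f\<in>B. N (f * x))" for x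
    using M(2)[of x] mult_right_mono[of s t "N x"] s by simp
  with M(1) s show ?thesis by (auto simp: null_bound_def)
qed

lemma null_bound_add:
  assumes "null_bound B a s" "null_bound B b t"
  shows "null_bound B (a + b) (s + t)"
proof -
  obtain M M' where M: "M \<ge> 0" "\<And>x. N (a * x) \<le> s * N x + M * (\<Sum>f\<in>B. N (f * x))"
    "M' \<ge> 0" "\<And>x. N (b * x) \<le> t * N x + M' * (\<Sum>f\<in>B. N (f * x))"
    using assms by (auto simp: null_bound_def)
  have "N ((a + b) * x) \<le> (s + t) * N x + (M + M') * (\<Sum>f\<in>B. N (f * x))" for x
    using N_add[of "a * x" "b * x"] M(2,4)[of x] by (simp add: algebra_simps)
  moreover have "M + M' \<ge> 0" "s + t \<ge> 0" using M assms by (auto simp: null_bound_def)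
  ultimately show ?thesis unfolding null_bound_def by blast
qed

text \<open>The bound for \<open>a\<close> is applied at \<open>b * x\<close>. By commutativity
  \<open>N (f * (b * x)) \<le> N b * N (f * x)\<close>, so the error remains a multiple of the same
  sum.\<close>

lemma null_bound_mult:
  assumes "null_bound B a s" "null_bound B b t"
  shows "null_bound B (a * b) (s * t)"
proof -
  obtain M M' where M: "M \<ge> 0" "\<And>x. N (a * x) \<le> s * N x + M * (\<Sum>f\<in>B. N (f * x))"
    "M' \<ge> 0" "\<And>x. N (b * x) \<le> t * N x + M' * (\<Sum>f\<in>B. N (f * x))"
    using assms by (auto simp: null_bound_def)
  have st: "s \<ge> 0" "t \<ge> 0" using assms by (auto simp: null_bound_def)
  have "N (a * b * x) \<le> s * t * N x + (s * M' + M * N b) * (\<Sum>f\<in>B. N (f * x))" for x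
  proof -
    have "(\<Sum>f\<in>B. N (f * (b * x))) \<le> (\<Sum>f\<in>B. N b * N (f * x))"
      using N_mult[of b "f * x" for f] by (intro sum_mono) (simp add: mult_ac)
    also have "\<dots> = N b * (\<Sum>f\<in>B. N (f * x))" by (simp add: sum_distrib_left)
    finally have "M * (\<Sum>f\<in>B. N (f * (b * x))) \<le> M * (N b * (\<Sum>f\<in>B. N (f * x)))"
      using M by (intro mult_left_mono)
    moreover have "s * N (b * x) \<le> s * (t * N x + M' * (\<Sum>f\<in>B. N (f * x)))"
      using st M by (intro mult_left_mono) auto
    ultimately show ?thesis
      using M(2)[of "b * x"] by (simp add: algebra_simps)
  qed
  moreover have "s * M' + M * N b \<ge> 0" "s * t \<ge> 0" using M st by auto
  ultimately show ?thesis unfolding null_bound_def by blast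
qed

lemma null_bound_scale:
  assumes "null_bound B a t"
  shows "null_bound B (h c * a) (cmod c * t)"
proof -
  obtain M where M: "M \<ge> 0" "\<And>x. N (a * x) \<le> t * N x + M * (\<Sum>f\<in>B. N (f * x))"
    using assms by (auto simp: null_bound_def)
  have "N (h c * a * x) \<le> cmod c * t * N x + (cmod c * M) * (\<Sum>f\<in>B. N (f * x))" for x
    using mult_left_mono[OF M(2)[of x], of "cmod c"]
    by (simp add: mult.assoc N_scale distrib_left)
  moreover have "cmod c * M \<ge> 0" "cmod c * t \<ge> 0" using M assms by (auto simp: null_bound_def)
  ultimately show ?thesis unfolding null_bound_def by blast
qed

text \<open>The inequalities pass from the bounds to their infimum. The essential point is that 1
  keeps seminorm 1: a bound \<open>t < 1\<close> for it is violated by elements that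
  \<open>B\<close> nearly annihilates.\<close>

lemma complex_seminormed_algebra_null_seminorm:
  assumes B: "finite B" "approx_null B"
  shows "complex_seminormed_algebra h (null_seminorm B)"
proof unfold_locales
  fix a b :: 'r and c :: complex
  have bd: "null_bound B a (null_seminorm B a + e)" if "e > 0" for a e
    using that by (intro null_bound_of_less) simp
  show "null_seminorm B (a + b) \<le> null_seminorm B a + null_seminorm B b"
  proof (rule field_le_epsilon)
    fix e :: real assume "e > 0"
    then show "null_seminorm B (a + b) \<le> null_seminorm B a + null_seminorm B b + e"
      using null_seminorm_le[OF null_bound_add[OF bd[of "e / 2" a] bd[of "e / 2" b]]] by simp
  qed
  show "null_seminorm B (a * b) \<le> null_seminorm B a * null_seminorm B b"
  proof (rule tendsto_lowerbound)
    show "((\<lambda>e. (null_seminorm B a + e) * (null_seminorm B b + e)) \<longlongrightarrow>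
        null_seminorm B a * null_seminorm B b) (at_right 0)"
      by (auto intro!: tendsto_eq_intros)
    show "\<forall>\<^sub>F e in at_right 0. null_seminorm B (a * b) \<le> (null_seminorm B a + e) * (null_seminorm B b + e)"
      using null_seminorm_le[OF null_bound_mult[OF bd bd]]
      by (auto intro!: eventually_mono[OF eventually_at_right_less])
  qed simp
  show "null_seminorm B (h c * a) \<le> cmod c * null_seminorm B a"
  proof (rule tendsto_lowerbound)
    show "((\<lambda>e. cmod c * (null_seminorm B a + e)) \<longlongrightarrow> cmod c * null_seminorm B a) (at_right 0)"
      by (auto intro!: tendsto_eq_intros)
    show "\<forall>\<^sub>F e in at_right 0. null_seminorm B (h c * a) \<le> cmod c * (null_seminorm B a + e)"
      using null_seminorm_le[OF null_bound_scale[OF bd]]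
      by (auto intro!: eventually_mono[OF eventually_at_right_less])
  qed simp
  show "null_seminorm B 1 = 1"
  proof (rule antisym)
    show "null_seminorm B 1 \<le> 1" using null_seminorm_le[OF null_bound_N, of B 1] by simp
    show "1 \<le> null_seminorm B 1"
    proof (rule ccontr)
      assume "\<not> 1 \<le> null_seminorm B 1"
      then obtain t where t: "null_seminorm B 1 < t" "t < 1" using dense not_le by blast
      then obtain M where M: "M \<ge> 0" "\<And>x. N x \<le> t * N x + M * (\<Sum>f\<in>B. N (f * x))"
        using null_bound_of_less[OF t(1)] unfolding null_bound_def by auto
      \<comment> \<open>With this \<open>e\<close> the error term is at most
        \<open>(1 - t) / 2\<close>; the added 1 keeps the denominator positive.\<close>
      define e where "e = (1 - t) / (2 * (M * card B + 1))"
      have pos: "M * card B + 1 > 0" using M(1) by (simp add: add_nonneg_pos)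
      have "e > 0" using t pos by (simp add: e_def)
      then obtain b where b: "N b = 1" "\<And>f. f \<in> B \<Longrightarrow> N (f * b) \<le> e"
        using B(2) unfolding approx_null_def by blast
      have "(\<Sum>f\<in>B. N (f * b)) \<le> card B * e"
        using sum_bounded_above[of B "\<lambda>f. N (f * b)" e] b by simp
      then have "M * (\<Sum>f\<in>B. N (f * b)) \<le> M * (card B * e)"
        using M(1) by (intro mult_left_mono)
      also have "\<dots> \<le> (M * card B + 1) * e" using \<open>e > 0\<close> by (simp add: algebra_simps)
      also have "\<dots> = (1 - t) / 2" using pos unfolding e_def by (simp add: divide_simps)
      finally show False using M(2)[of b] b(1) t by simp
    qed
  qed
qed

text \<open>\<open>ex_approx_null\<close> for \<open>null_seminorm B\<close> gives \<open>c\<close>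
  and an element \<open>a\<close> of seminorm 1 that \<open>C - c\<close> nearly annihilates. The
  joint witness for \<open>N\<close> is a product \<open>a * x\<close>, where \<open>x\<close> is so
  close to being annihilated by \<open>B\<close> that both error terms are negligible against
  \<open>N (a * x)\<close>.\<close>

lemma approx_null_insert:
  assumes B: "finite B" "approx_null B"
  shows "\<exists>c. approx_null (insert (C - h c) B)"
proof -
  interpret Q: complex_seminormed_algebra h "null_seminorm B"
    using complex_seminormed_algebra_null_seminorm[OF B] .
  obtain c where c: "Q.approx_null {C - h c}" using Q.ex_approx_null by blast
  have "approx_null (insert (C - h c) B)"
  proof (rule approx_nullI)
    fix e :: real assume e: "e > 0"
    then have "e / 4 > 0" by simp
    then obtain a where a: "null_seminorm B a = 1" "null_seminorm B ((C - h c) * a) \<le> e / 4"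
      using c unfolding Q.approx_null_def by blast
    then have "null_seminorm B ((C - h c) * a) < e / 2" using e by simp
    then obtain M where M: "M \<ge> 0"
      "\<And>x. N ((C - h c) * a * x) \<le> e / 2 * N x + M * (\<Sum>f\<in>B. N (f * x))"
      using null_bound_of_less[of B "(C - h c) * a"] unfolding null_bound_def by blast
    \<comment> \<open>Chosen so that \<open>e * M'\<close> covers the error \<open>M\<close> in the
      bound for \<open>(C - c) a\<close> and the factor \<open>N a\<close> in
      \<open>N (f * (a * x))\<close> together.\<close>
    define M' where "M' = (M + N a) / e"
    have "M' \<ge> 0" using M(1) e by (simp add: M'_def)
    \<comment> \<open>Since \<open>a\<close> has seminorm 1, the bound 1/2 fails for every constant,
      in particular for \<open>M'\<close>; the failure provides \<open>x\<close>.\<close>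
    have "\<not> null_bound B a (1 / 2)" using a(1) null_seminorm_le[of B a "1 / 2"] by auto
    then obtain x where x: "N (a * x) > 1 / 2 * N x + M' * (\<Sum>f\<in>B. N (f * x))"
      using \<open>M' \<ge> 0\<close> unfolding null_bound_def by (meson not_le zero_le_divide_1_iff zero_le_numeral)
    let ?\<sigma> = "\<Sum>f\<in>B. N (f * x)"
    have eM': "e * (M' * ?\<sigma>) = M * ?\<sigma> + N a * ?\<sigma>" using e by (simp add: M'_def field_simps)
    have "e / 2 * N x + M * ?\<sigma> + N a * ?\<sigma> = e * (1 / 2 * N x + M' * ?\<sigma>)"
      using eM' by (simp add: algebra_simps)
    also have "\<dots> \<le> e * N (a * x)" using x e by (intro mult_left_mono) auto
    finally have main: "e / 2 * N x + M * ?\<sigma> + N a * ?\<sigma> \<le> e * N (a * x)" .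
    have nonneg: "0 \<le> M * ?\<sigma>" "0 \<le> N a * ?\<sigma>" "0 \<le> e / 2 * N x" "0 \<le> M' * ?\<sigma>"
      using M(1) e sum_N_nonneg[where B = B and x = x] \<open>M' \<ge> 0\<close> by auto
    have "N (f * (a * x)) \<le> e * N (a * x)" if "f \<in> B" for f
    proof -
      have "N (f * (a * x)) \<le> N a * N (f * x)" using N_mult[of a "f * x"] by (simp add: mult_ac)
      also have "\<dots> \<le> N a * ?\<sigma>" using that B(1) by (intro mult_left_mono member_le_sum) auto
      finally show ?thesis using main nonneg by linarith
    qed
    moreover have "N ((C - h c) * (a * x)) \<le> e * N (a * x)"
      using M(2)[of x] main nonneg unfolding mult.assoc[of "C - h c" a x] by linarith
    moreover have "N (a * x) > 0" using x nonneg N_nonneg[of x] by linarith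
    ultimately show "\<exists>b. N b > 0 \<and> (\<forall>f\<in>insert (C - h c) B. N (f * b) \<le> e * N b)"
      by (intro exI[of _ "a * x"]) auto
  qed
  then show ?thesis by blast
qed

text \<open>The elements \<open>X i\<close> are treated one at a time by
  \<open>approx_null_insert\<close>. Retaining \<open>B\<close> matters: applied to
  \<open>B = {p - c}\<close> with the variables as \<open>X\<close>, it links the value
  \<open>c\<close> of \<open>p\<close> to the point \<open>l\<close>.\<close>

lemma approx_null_extend:
  assumes "finite I" "finite B" "approx_null B"
  shows "\<exists>l. approx_null (B \<union> (\<lambda>i. X i - h (l i)) ` I)"
  using assms(1)
proof induction
  case empty
  then show ?case using assms by simp
next
  case (insert j I)
  then obtain l where l: "approx_null (B \<union> (\<lambda>i. X i - h (l i)) ` I)" by blast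
  moreover have "finite (B \<union> (\<lambda>i. X i - h (l i)) ` I)" using assms insert by simp
  ultimately obtain c where c: "approx_null (insert (X j - h c) (B \<union> (\<lambda>i. X i - h (l i)) ` I))"
    using approx_null_insert by blast
  have "(\<lambda>i. X i - h ((l(j := c)) i)) ` I = (\<lambda>i. X i - h (l i)) ` I"
    using insert by (intro image_cong) auto
  then have "B \<union> (\<lambda>i. X i - h ((l(j := c)) i)) ` insert j I = insert (X j - h c) (B \<union> (\<lambda>i. X i - h (l i)) ` I)"
    by simp
  with c show ?case by (intro exI[of _ "l(j := c)"]) (simp only:)
qed

end

section \<open>Polynomials in a commuting tuple\<close>

lemma scaleC_zero_left [simp]: "0 *\<^sub>C (x::'a::complex_vector) = 0"
  using scaleC_of_real[of 0 x] by simp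

lemma scaleC_one [simp]: "1 *\<^sub>C (x::'a::complex_vector) = x"
  using scaleC_of_real[of 1 x] by simp

lemma scaleC_zero_right [simp]: "c *\<^sub>C (0::'a::complex_vector) = 0"
  using scaleC_add_right[of c 0 0] by simp

lemma scaleC_sum_right: "c *\<^sub>C (\<Sum>i\<in>I. f i :: 'a::complex_vector) = (\<Sum>i\<in>I. c *\<^sub>C f i)"
  by (induction I rule: infinite_finite_induct) (auto simp: scaleC_add_right)

lemma norm_scaleC: "norm (c *\<^sub>C (x::'a::complex_inner)) = cmod c * norm x"
proof -
  have "cinner (c *\<^sub>C x) (c *\<^sub>C x) = c * cnj (c * cinner x x)"
    by (metis cinner_commute cinner_scaleC_left)
  also have "\<dots> = of_real ((cmod c)\<^sup>2) * cnj (cinner x x)"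
    by (simp only: complex_norm_square complex_cnj_mult mult.assoc)
  finally have "Re (cinner (c *\<^sub>C x) (c *\<^sub>C x)) = (cmod c)\<^sup>2 * Re (cinner x x)"
    by (simp only: Re_complex_of_real Im_complex_of_real times_complex.sel complex_cnj) simp
  then show ?thesis by (simp add: norm_eq_sqrt_cinner real_sqrt_mult)
qed

lemma bounded_linear_scaleC: "bounded_linear (\<lambda>x::'a::complex_inner. c *\<^sub>C x)"
proof (rule bounded_linear_intro)
  fix r and x :: 'a
  show "c *\<^sub>C r *\<^sub>R x = r *\<^sub>R c *\<^sub>C x"
    by (simp add: scaleC_scaleC mult.commute flip: scaleC_of_real)
  show "norm (c *\<^sub>C x) \<le> norm x * cmod c" by (simp add: norm_scaleC)
qed (rule scaleC_add_right)

lemma bounded_clinearD: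
  assumes "bounded_clinear A"
  shows "bounded_linear A" "A (c *\<^sub>C x) = c *\<^sub>C A x"
  using assms by (auto simp: bounded_clinear_def)

lemma bounded_clinear_id: "bounded_clinear (\<lambda>x. x)"
  by (simp add: bounded_clinear_def bounded_linear_ident)

lemma bounded_clinear_compose:
  "bounded_clinear f \<Longrightarrow> bounded_clinear g \<Longrightarrow> bounded_clinear (\<lambda>x. f (g x))"
  by (simp add: bounded_clinear_def bounded_linear_compose)

lemma bounded_clinear_scaleC: "bounded_clinear f \<Longrightarrow> bounded_clinear (\<lambda>x. c *\<^sub>C f x)"
  by (simp add: bounded_clinear_def bounded_linear_compose[OF bounded_linear_scaleC] scaleC_scaleC mult.commute)

lemma bounded_clinear_sum:
  "(\<And>i. i \<in> I \<Longrightarrow> bounded_clinear (f i)) \<Longrightarrow> bounded_clinear (\<lambda>x. \<Sum>i\<in>I. f i x)"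
  by (auto simp: bounded_clinear_def scaleC_sum_right intro!: bounded_linear_sum)

section \<open>Formal polynomials and their values\<close>

abbreviation cpoly_const :: "complex \<Rightarrow> 'd cpolynomial" where
  "cpoly_const c \<equiv> Poly_Mapping.single 0 c"

definition cpoly_var :: "'d \<Rightarrow> 'd cpolynomial" where
  "cpoly_var i = Poly_Mapping.single (Poly_Mapping.single i 1) 1"

lemma poly_mapping_eq_sum_single:
  fixes p :: "'a \<Rightarrow>\<^sub>0 'b::comm_monoid_add"
  shows "p = (\<Sum>m\<in>Poly_Mapping.keys p. Poly_Mapping.single m (Poly_Mapping.lookup p m))"
proof (rule poly_mapping_eqI)
  fix k
  show "Poly_Mapping.lookup p k =
    Poly_Mapping.lookup (\<Sum>m\<in>Poly_Mapping.keys p. Poly_Mapping.single m (Poly_Mapping.lookup p m)) k"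
    by (cases "k \<in> Poly_Mapping.keys p")
      (auto simp: lookup_sum lookup_single when_def in_keys_iff sum.delta)
qed

lemma poly_mapping_single_add_induct [case_names single add]:
  fixes p :: "'a \<Rightarrow>\<^sub>0 'b::comm_monoid_add"
  assumes single: "\<And>m c. P (Poly_Mapping.single m c)" and add: "\<And>p q. P p \<Longrightarrow> P q \<Longrightarrow> P (p + q)"
  shows "P p"
proof -
  have "P 0" using single[of undefined 0] by simp
  then have "P (\<Sum>m\<in>A. Poly_Mapping.single m (Poly_Mapping.lookup p m))" for A
    by (induction A rule: infinite_finite_induct) (auto intro: single add)
  then show ?thesis using poly_mapping_eq_sum_single[of p] by metis
qed

lemma poly_eval_single:
  "poly_eval (Poly_Mapping.single m c) z = c * (\<Prod>i\<in>UNIV. (z $ i) ^ Poly_Mapping.lookup m i)"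
  by (cases "c = 0") (simp_all add: poly_eval_def)

lemma poly_eval_add: "poly_eval (p + q) z = poly_eval p z + poly_eval q z"
proof -
  let ?A = "Poly_Mapping.keys p \<union> Poly_Mapping.keys q"
  have *: "poly_eval r z = (\<Sum>m\<in>?A. Poly_Mapping.lookup r m * (\<Prod>i\<in>UNIV. (z $ i) ^ Poly_Mapping.lookup m i))"
    if "Poly_Mapping.keys r \<subseteq> ?A" for r
    unfolding poly_eval_def using that by (intro sum.mono_neutral_left) (auto simp: in_keys_iff)
  show ?thesis
    using *[of p] *[of q] *[OF keys_add]
    by (simp add: lookup_add distrib_right sum.distrib)
qed

lemma poly_eval_mult: "poly_eval (p * q) z = poly_eval p z * poly_eval q z"
proof (induction p rule: poly_mapping_single_add_induct)
  case (single m c)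
  show ?case
    by (induction q rule: poly_mapping_single_add_induct)
      (simp_all add: mult_single poly_eval_single lookup_add power_add prod.distrib
        poly_eval_add distrib_left)
qed (simp add: poly_eval_add distrib_right)

lemma poly_eval_const [simp]: "poly_eval (cpoly_const c) z = c"
  by (simp add: poly_eval_single)

lemma poly_eval_1 [simp]: "poly_eval 1 z = 1"
  using poly_eval_const[of 1 z] by simp

lemma poly_eval_power: "poly_eval (p ^ n) z = poly_eval p z ^ n"
  by (induction n) (simp_all add: poly_eval_mult)

interpretation cpoly: complex_algebra_map "cpoly_const :: complex \<Rightarrow> 'd cpolynomial"
  by unfold_locales (simp_all add: single_add mult_single)

lemma single_eq_const_times_prod_vars:
  fixes m :: "'d::finite \<Rightarrow>\<^sub>0 nat"
  shows "Poly_Mapping.single m c = cpoly_const c * (\<Prod>i\<in>UNIV. cpoly_var i ^ Poly_Mapping.lookup m i)"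
proof -
  have pow: "cpoly_var i ^ k = Poly_Mapping.single (Poly_Mapping.single i k) 1" for i :: 'd and k
    by (induction k) (simp_all add: cpoly_var_def mult_single flip: single_add)
  have "(\<Prod>i\<in>A. Poly_Mapping.single (f i) (1::complex)) = Poly_Mapping.single (\<Sum>i\<in>A. f i) 1"
    for A :: "'d set" and f :: "'d \<Rightarrow> 'd \<Rightarrow>\<^sub>0 nat"
    by (induction A rule: infinite_finite_induct) (simp_all add: mult_single)
  moreover have "(\<Sum>i\<in>UNIV. Poly_Mapping.single i (Poly_Mapping.lookup m i)) = m"
    by (rule poly_mapping_eqI) (simp add: lookup_sum lookup_single when_def)
  ultimately show ?thesis by (simp add: pow mult_single)
qed

text \<open>The property holds for constants and variables and is preserved by sums and products,
  the latter by \<open>fg - f(l) g(l) = g (f - f(l)) + f(l) (g - g(l))\<close>. These generate all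
  polynomials.\<close>

lemma cpoly_minus_value_in_ideal:
  fixes p :: "'d::finite cpolynomial"
  shows "\<exists>q. p - cpoly_const (poly_eval p l) = (\<Sum>i\<in>UNIV. q i * (cpoly_var i - cpoly_const (l $ i)))"
proof -
  define good where "good = (\<lambda>p :: 'd cpolynomial.
    \<exists>q. p - cpoly_const (poly_eval p l) = (\<Sum>i\<in>UNIV. q i * (cpoly_var i - cpoly_const (l $ i))))"
  have good_add: "good (f + g)" if "good f" "good g" for f g
  proof -
    from that obtain q r where qr:
      "f - cpoly_const (poly_eval f l) = (\<Sum>i\<in>UNIV. q i * (cpoly_var i - cpoly_const (l $ i)))"
      "g - cpoly_const (poly_eval g l) = (\<Sum>i\<in>UNIV. r i * (cpoly_var i - cpoly_const (l $ i)))"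
      by (auto simp: good_def)
    have "f + g - cpoly_const (poly_eval (f + g) l) =
        (f - cpoly_const (poly_eval f l)) + (g - cpoly_const (poly_eval g l))"
      by (simp add: poly_eval_add cpoly.h_add)
    also have "\<dots> = (\<Sum>i\<in>UNIV. (q i + r i) * (cpoly_var i - cpoly_const (l $ i)))"
      unfolding qr by (simp only: distrib_right sum.distrib)
    finally show ?thesis unfolding good_def by (rule exI[of _ "\<lambda>i. q i + r i"])
  qed
  have good_mult: "good (f * g)" if "good f" "good g" for f g
  proof -
    from that obtain q r where qr:
      "f - cpoly_const (poly_eval f l) = (\<Sum>i\<in>UNIV. q i * (cpoly_var i - cpoly_const (l $ i)))"
      "g - cpoly_const (poly_eval g l) = (\<Sum>i\<in>UNIV. r i * (cpoly_var i - cpoly_const (l $ i)))"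
      by (auto simp: good_def)
    have "f * g - cpoly_const (poly_eval (f * g) l) = g * (f - cpoly_const (poly_eval f l)) +
        cpoly_const (poly_eval f l) * (g - cpoly_const (poly_eval g l))"
      by (simp add: poly_eval_mult cpoly.h_mult algebra_simps)
    also have "\<dots> = (\<Sum>i\<in>UNIV. (g * q i + cpoly_const (poly_eval f l) * r i) *
        (cpoly_var i - cpoly_const (l $ i)))"
      unfolding qr sum_distrib_left sum.distrib[symmetric] by (rule sum.cong) (auto simp: distrib_right mult.assoc)
    finally show ?thesis
      unfolding good_def by (rule exI[of _ "\<lambda>i. g * q i + cpoly_const (poly_eval f l) * r i"])
  qed
  have good_const: "good (cpoly_const c)" for c
    unfolding good_def by (rule exI[of _ "\<lambda>_. 0"]) simp
  have good_var: "good (cpoly_var j)" for j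
  proof -
    have "poly_eval (cpoly_var j) l = (\<Prod>i\<in>UNIV. if i = j then l $ i else 1)"
      unfolding cpoly_var_def poly_eval_single mult_1_left
      by (rule prod.cong) (auto simp: lookup_single when_def)
    then have "poly_eval (cpoly_var j) l = l $ j" by simp
    moreover have "(\<Sum>i\<in>UNIV. (if i = j then 1 else 0) * (cpoly_var i - cpoly_const (l $ i))) =
        (\<Sum>i\<in>UNIV. if i = j then cpoly_var i - cpoly_const (l $ i) else 0)"
      by (rule sum.cong) auto
    ultimately show ?thesis
      unfolding good_def by (intro exI[of _ "\<lambda>i. if i = j then 1 else 0"]) simp
  qed
  have good_power: "good (f ^ n)" if "good f" for f n
    using good_const[of 1] by (induction n) (simp_all add: good_mult that)
  have good_prod: "good (\<Prod>i\<in>A. f i)" if "\<And>i. good (f i)" for A :: "'d set" and f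
    using good_const[of 1] by (induction A rule: infinite_finite_induct) (simp_all add: good_mult that)
  have "good p"
  proof (induction p rule: poly_mapping_single_add_induct)
    case (single m c)
    show ?case
      by (subst single_eq_const_times_prod_vars) (intro good_mult good_const good_prod good_power good_var)
  qed (rule good_add)
  then show ?thesis by (simp add: good_def)
qed

section \<open>The polynomial functional calculus\<close>

lemma commuting_bounded_tupleD:
  assumes "commuting_bounded_tuple T"
  shows "bounded_clinear (T i)" "T i (T j x) = T j (T i x)"
  using assms unfolding commuting_bounded_tuple_def by (auto simp: fun_eq_iff)

lemma monomial_op_0 [simp]: "monomial_op 0 T = id"
proof -
  have "foldr (\<lambda>i A. (T i ^^ Poly_Mapping.lookup 0 i) \<circ> A) xs id = id" for xs
    by (induction xs) auto
  then show ?thesis by (simp add: monomial_op_def)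
qed

text \<open>The claim is proved by induction for the product over an arbitrary list of indices;
  \<open>pow_F\<close> moves powers of \<open>T i\<close> past the remaining factors.\<close>

lemma monomial_op_add:
  fixes T :: "'d::{finite,linorder} \<Rightarrow> 'a \<Rightarrow> 'a"
  assumes comm: "\<And>i j x. T i (T j x) = T j (T i x)"
  shows "monomial_op (m + m') T = monomial_op m T \<circ> monomial_op m' T"
proof -
  define F where "F = (\<lambda>m xs. foldr (\<lambda>i A. (T i ^^ Poly_Mapping.lookup m i) \<circ> A) xs id)"
  have F_Nil: "F m [] x = x" for m x by (simp add: F_def)
  have F_Cons: "F m (i # xs) x = (T i ^^ Poly_Mapping.lookup m i) (F m xs x)" for m i xs x
    by (simp add: F_def)
  have pow1: "(T i ^^ k) (T j x) = T j ((T i ^^ k) x)" for i j k x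
    by (induction k) (simp_all add: comm)
  have pow: "(T i ^^ k) ((T j ^^ l) x) = (T j ^^ l) ((T i ^^ k) x)" for i j k l x
    by (induction l) (simp_all add: pow1)
  have pow_F: "(T i ^^ k) (F m xs x) = F m xs ((T i ^^ k) x)" for i k xs m x
    by (induction xs) (simp_all add: F_Nil F_Cons pow[of k i])
  have "F (m + m') xs x = F m xs (F m' xs x)" for xs x
    by (induction xs) (simp_all add: F_Nil F_Cons lookup_add funpow_add pow_F)
  then show ?thesis by (simp add: monomial_op_def F_def fun_eq_iff)
qed

lemma monomial_op_var:
  fixes T :: "'d::{finite,linorder} \<Rightarrow> 'a \<Rightarrow> 'a"
  shows "monomial_op (Poly_Mapping.single i 1) T = T i"
proof -
  have "distinct xs \<Longrightarrow> foldr (\<lambda>j A. (T j ^^ Poly_Mapping.lookup (Poly_Mapping.single i 1) j) \<circ> A) xs id =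
      (if i \<in> set xs then T i else id)" for xs
    by (induction xs) (auto simp: lookup_single when_def)
  then show ?thesis by (simp add: monomial_op_def)
qed

lemma bounded_clinear_monomial_op:
  assumes "\<And>i. bounded_clinear (T i)"
  shows "bounded_clinear (monomial_op m T)"
proof -
  have pow: "bounded_clinear (T i ^^ k)" for i k
    by (induction k) (simp_all add: bounded_clinear_id bounded_clinear_compose[OF assms] comp_def id_def)
  have "bounded_clinear (foldr (\<lambda>i A. (T i ^^ Poly_Mapping.lookup m i) \<circ> A) xs id)" for xs
    by (induction xs) (simp_all add: bounded_clinear_id bounded_clinear_compose[OF pow] comp_def id_def)
  then show ?thesis by (simp add: monomial_op_def)
qed

lemma poly_op_single: "poly_op (Poly_Mapping.single m c) T x = c *\<^sub>C monomial_op m T x"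
  by (cases "c = 0") (simp_all add: poly_op_def)

lemma poly_op_add: "poly_op (p + q) T x = poly_op p T x + poly_op q T x"
proof -
  let ?A = "Poly_Mapping.keys p \<union> Poly_Mapping.keys q"
  have *: "poly_op r T x = (\<Sum>m\<in>?A. Poly_Mapping.lookup r m *\<^sub>C monomial_op m T x)"
    if "Poly_Mapping.keys r \<subseteq> ?A" for r
    unfolding poly_op_def using that by (intro sum.mono_neutral_left) (auto simp: in_keys_iff)
  show ?thesis
    using *[of p] *[of q] *[OF keys_add] by (simp add: lookup_add scaleC_add_left sum.distrib)
qed

lemma poly_op_0 [simp]: "poly_op 0 T x = 0"
  by (simp add: poly_op_def)

lemma poly_op_sum: "poly_op (\<Sum>i\<in>I. f i) T x = (\<Sum>i\<in>I. poly_op (f i) T x)"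
  by (induction I rule: infinite_finite_induct) (simp_all add: poly_op_add)

lemma poly_op_diff: "poly_op (p - q) T x = poly_op p T x - poly_op q T x"
  using poly_op_add[of "p - q" q T x] by simp

lemma poly_op_const: "poly_op (cpoly_const c) T x = c *\<^sub>C x"
  by (simp add: poly_op_single)

lemma poly_op_1 [simp]: "poly_op 1 T x = x"
  using poly_op_const[of 1 T x] by simp

lemma poly_op_var: "poly_op (cpoly_var i) T x = T i x"
  by (simp add: cpoly_var_def poly_op_single monomial_op_var[unfolded One_nat_def])

lemma bounded_clinear_poly_op:
  assumes "commuting_bounded_tuple T"
  shows "bounded_clinear (poly_op p T)"
proof -
  have "bounded_clinear (\<lambda>x. poly_op p T x)"
    unfolding poly_op_def
    by (intro bounded_clinear_sum bounded_clinear_scaleC bounded_clinear_monomial_op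
        commuting_bounded_tupleD[OF assms])
  then show ?thesis .
qed

lemma poly_op_mult:
  assumes T: "commuting_bounded_tuple T"
  shows "poly_op (p * q) T x = poly_op p T (poly_op q T x)"
proof (induction p rule: poly_mapping_single_add_induct)
  case (single m c)
  have lin: "monomial_op m T (c *\<^sub>C x) = c *\<^sub>C monomial_op m T x"
    "monomial_op m T (x + y) = monomial_op m T x + monomial_op m T y" for c x y
    using bounded_clinear_monomial_op[of T m] commuting_bounded_tupleD(1)[OF T]
    by (auto simp: bounded_clinear_def linear_simps)
  show ?case
  proof (induction q rule: poly_mapping_single_add_induct)
    case (single m' c')
    show ?case
      using monomial_op_add[of T m m'] commuting_bounded_tupleD(2)[OF T]
      by (simp add: mult_single poly_op_single scaleC_scaleC lin)
  qed (simp add: distrib_left poly_op_add poly_op_single lin scaleC_add_right)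
qed (simp add: distrib_right poly_op_add)

section \<open>Operator norms of polynomials in a tuple\<close>

lemma op_matrix_norm_1:
  assumes "bounded_linear A"
  shows "op_matrix_norm 1 (\<lambda>i j. A) = onorm A"
proof (rule antisym)
  have *: "op_matrix_norm 1 (\<lambda>i j. A) = (SUP x\<in>{x :: nat \<Rightarrow> 'a. norm (x 0) \<le> 1}. norm (A (x 0)))"
    by (simp add: op_matrix_norm_def L2_set_def lessThan_Suc)
  have le: "norm (A (x 0)) \<le> onorm A" if "norm (x 0) \<le> 1" for x :: "nat \<Rightarrow> 'a"
    using onorm[OF assms, of "x 0"] that onorm_pos_le[OF assms] by (meson mult_left_le order.trans)
  have bdd: "bdd_above ((\<lambda>x :: nat \<Rightarrow> 'a. norm (A (x 0))) ` {x. norm (x 0) \<le> 1})"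
    using le by (auto intro!: bdd_aboveI2)
  show "op_matrix_norm 1 (\<lambda>i j. A) \<le> onorm A"
    unfolding * using le by (intro cSUP_least) (auto intro!: exI[of _ "\<lambda>_. 0"])
  show "onorm A \<le> op_matrix_norm 1 (\<lambda>i j. A)"
  proof (rule onorm_bound)
    show "0 \<le> op_matrix_norm 1 (\<lambda>i j. A)"
      unfolding * using order.trans[OF norm_ge_zero cSUP_upper[OF _ bdd, of "\<lambda>_. 0"]] by simp
    fix x
    \<comment> \<open>The vector \<open>sgn x\<close> lies in the unit ball for every
      \<open>x\<close>, being 0 when \<open>x = 0\<close>.\<close>
    have "norm (A (sgn x)) \<le> op_matrix_norm 1 (\<lambda>i j. A)"
      unfolding * using cSUP_upper[OF _ bdd, of "\<lambda>_. sgn x"] by (simp add: norm_sgn)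
    then have "norm x * norm (A (sgn x)) \<le> norm x * op_matrix_norm 1 (\<lambda>i j. A)"
      by (intro mult_left_mono) auto
    moreover have "norm x * norm (A (sgn x)) = norm (A x)"
      using linear_scale[OF bounded_linear.linear[OF assms], of "norm x" "sgn x"]
      by (cases "x = 0") (simp_all add: linear_0[OF bounded_linear.linear[OF assms]] sgn_div_norm)
    ultimately show "norm (A x) \<le> op_matrix_norm 1 (\<lambda>i j. A) * norm x" by (simp add: mult.commute)
  qed
qed

text \<open>The case of matrices of size 1, where \<open>op_matrix_norm\<close> is the operator
  norm.\<close>

lemma poly_map_completely_contractiveD:
  assumes "poly_map_completely_contractive S T" "commuting_bounded_tuple S" "commuting_bounded_tuple T"
  shows "onorm (poly_op p T) \<le> onorm (poly_op p S)"
proof -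
  have "op_matrix_norm 1 (\<lambda>i j. poly_op p T) \<le> op_matrix_norm 1 (\<lambda>i j. poly_op p S)"
    using assms(1)[unfolded poly_map_completely_contractive_def, THEN conjunct2, rule_format, of 1 "\<lambda>_ _. p"] .
  then show ?thesis
    using assms by (simp only: op_matrix_norm_1 bounded_clinear_poly_op bounded_clinearD)
qed

text \<open>The vector \<open>x\<close> excludes the zero space, on which the identity has norm 0
  instead of 1.\<close>

lemma complex_seminormed_algebra_poly_op:
  fixes S :: "'d::{finite,linorder} \<Rightarrow> 'a::complex_inner \<Rightarrow> 'a"
  assumes S: "commuting_bounded_tuple S" and nontrivial: "(x::'a) \<noteq> 0"
  shows "complex_seminormed_algebra cpoly_const (\<lambda>p. onorm (poly_op p S))"
proof unfold_locales
  fix p q :: "'d cpolynomial" and c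
  note bl = bounded_clinearD(1)[OF bounded_clinear_poly_op[OF S]]
  show "onorm (poly_op (p + q) S) \<le> onorm (poly_op p S) + onorm (poly_op q S)"
  proof -
    have "poly_op (p + q) S = (\<lambda>x. poly_op p S x + poly_op q S x)"
      by (simp add: fun_eq_iff poly_op_add)
    then show ?thesis using onorm_triangle[OF bl bl, of p q] by simp
  qed
  show "onorm (poly_op (p * q) S) \<le> onorm (poly_op p S) * onorm (poly_op q S)"
  proof -
    have "poly_op (p * q) S = poly_op p S \<circ> poly_op q S"
      by (simp add: fun_eq_iff poly_op_mult[OF S])
    then show ?thesis using onorm_compose[OF bl bl, of p q] by simp
  qed
  show "onorm (poly_op (cpoly_const c * p) S) \<le> cmod c * onorm (poly_op p S)"
    using mult_left_mono[OF onorm[OF bl], of "cmod c"]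
    by (intro onorm_bound) (simp_all add: poly_op_mult[OF S] poly_op_const norm_scaleC mult.assoc onorm_pos_le[OF bl])
  show "onorm (poly_op 1 S) = 1"
  proof (rule antisym)
    show "onorm (poly_op 1 S) \<le> 1" by (rule onorm_bound) simp_all
    show "1 \<le> onorm (poly_op 1 S)"
      using onorm[OF bl, of 1 x] nontrivial by simp
  qed
qed

section \<open>The Koszul complex\<close>

definition koszul_sign :: "'d::linorder \<Rightarrow> 'd set \<Rightarrow> real" where
  "koszul_sign i J = (- 1) ^ card {j\<in>J. j < i}"

lemma koszul_sign_square: "koszul_sign i J * koszul_sign i J = 1"
  by (simp add: koszul_sign_def flip: power_mult_distrib)

lemma koszul_sign_insert:
  fixes i k :: "'d::{finite,linorder}"
  assumes "k \<notin> J"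
  shows "koszul_sign i (insert k J) = (if k < i then - koszul_sign i J else koszul_sign i J)"
proof -
  have "{j \<in> insert k J. j < i} = (if k < i then insert k {j\<in>J. j < i} else {j\<in>J. j < i})"
    by auto
  then show ?thesis using assms by (auto simp: koszul_sign_def)
qed

lemma koszul_sign_remove:
  fixes i k :: "'d::{finite,linorder}"
  assumes "k \<in> J"
  shows "koszul_sign i (J - {k}) = (if k < i then - koszul_sign i J else koszul_sign i J)"
  using koszul_sign_insert[of k "J - {k}" i] assms by (auto simp: insert_absorb split: if_splits)

lemma koszul_diff_eq: "koszul_diff T \<omega> J = (\<Sum>i\<in>J. koszul_sign i J *\<^sub>R T i (\<omega> (J - {i})))"
  by (simp add: koszul_diff_def koszul_sign_def)

text \<open>Removing \<open>i\<close> and then \<open>k\<close>, or \<open>k\<close> and then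
  \<open>i\<close>, leads to the same coefficient. The operators commute and the signs are opposite,
  so the double sum equals its own negative.\<close>

lemma koszul_diff_koszul_diff:
  fixes A :: "'d::{finite,linorder} \<Rightarrow> 'b::real_vector \<Rightarrow> 'b"
  assumes lin: "\<And>i. linear (A i)" and comm: "\<And>i j x. A i (A j x) = A j (A i x)"
  shows "koszul_diff A (koszul_diff A \<omega>) J = 0"
proof -
  let ?P = "{(i, k). i \<in> J \<and> k \<in> J \<and> i \<noteq> k}"
  define f where "f = (\<lambda>i k. (koszul_sign i J * koszul_sign k (J - {i})) *\<^sub>R A i (A k (\<omega> (J - {i} - {k}))))"
  have anti: "f i k = - f k i" if "i \<in> J" "k \<in> J" "i \<noteq> k" for i k
  proof -
    have "koszul_sign i J * koszul_sign k (J - {i}) = - (koszul_sign k J * koszul_sign i (J - {k}))"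
      using that by (auto simp: koszul_sign_remove)
    moreover have "J - {i} - {k} = J - {k} - {i}" by auto
    ultimately show ?thesis by (simp add: f_def comm[of i k])
  qed
  have "koszul_diff A (koszul_diff A \<omega>) J = (\<Sum>i\<in>J. \<Sum>k\<in>J - {i}. f i k)"
    unfolding koszul_diff_eq f_def
    by (intro sum.cong) (simp_all add: linear_sum[OF lin] linear_scale[OF lin] scaleR_sum_right)
  also have "\<dots> = (\<Sum>(i, k)\<in>?P. f i k)"
    by (subst sum.Sigma) (auto intro!: sum.cong)
  finally have eq: "koszul_diff A (koszul_diff A \<omega>) J = (\<Sum>(i, k)\<in>?P. f i k)" .
  have "(\<Sum>(i, k)\<in>?P. f i k) = (\<Sum>(i, k)\<in>?P. f k i)"
    by (rule sum.reindex_bij_witness[of _ prod.swap prod.swap]) auto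
  also have "\<dots> = (\<Sum>(i, k)\<in>?P. - f i k)"
    using anti by (intro sum.cong) auto
  also have "\<dots> = - (\<Sum>(i, k)\<in>?P. f i k)"
    by (simp add: sum_negf split_def)
  finally have "2 *\<^sub>R (\<Sum>(i, k)\<in>?P. f i k) = 0"
    by (simp only: scaleR_2 eq_neg_iff_add_eq_0)
  then show ?thesis using eq by simp
qed

text \<open>The contraction (interior product) along \<open>Q\<close>, which lowers the degree by
  one: the coefficient at \<open>I\<close> collects those at the sets
  \<open>I \<union> {i}\<close>.\<close>

definition koszul_homotopy ::
  "('d::{finite,linorder} \<Rightarrow> 'a::real_vector \<Rightarrow> 'a) \<Rightarrow> ('d set \<Rightarrow> 'a) \<Rightarrow> ('d set \<Rightarrow> 'a)" where
  "koszul_homotopy Q \<omega> I = (\<Sum>i\<in>- I. koszul_sign i I *\<^sub>R Q i (\<omega> (insert i I)))"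

text \<open>For \<open>i\<close> in \<open>J\<close> and \<open>k\<close> outside \<open>J\<close>,
  the first composition contributes \<open>g i k\<close> and the second \<open>- g i k\<close>. What
  remains are the diagonal terms, those with \<open>i\<close> in \<open>J\<close> from the first
  composition and the others from the second.\<close>

lemma koszul_homotopy_formula:
  fixes A Q :: "'d::{finite,linorder} \<Rightarrow> 'b::real_vector \<Rightarrow> 'b"
  assumes A: "\<And>i. linear (A i)" and Q: "\<And>i. linear (Q i)"
    and comm: "\<And>i j x. Q i (A j x) = A j (Q i x)"
  shows "koszul_diff A (koszul_homotopy Q \<omega>) J + koszul_homotopy Q (koszul_diff A \<omega>) J =
    (\<Sum>i\<in>UNIV. A i (Q i (\<omega> J)))"
proof -
  define g where "g = (\<lambda>i k. (koszul_sign i J * koszul_sign k (J - {i})) *\<^sub>R A i (Q k (\<omega> (insert k (J - {i})))))"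
  have "koszul_diff A (koszul_homotopy Q \<omega>) J = (\<Sum>i\<in>J. A i (Q i (\<omega> J)) + (\<Sum>k\<in>- J. g i k))"
    unfolding koszul_diff_eq
  proof (rule sum.cong[OF refl])
    fix i assume i: "i \<in> J"
    have "koszul_sign i J *\<^sub>R A i (koszul_homotopy Q \<omega> (J - {i})) = (\<Sum>k\<in>- (J - {i}). g i k)"
      by (simp add: koszul_homotopy_def g_def linear_sum[OF A] linear_scale[OF A] scaleR_sum_right)
    also have "- (J - {i}) = insert i (- J)" using i by auto
    also have "(\<Sum>k\<in>insert i (- J). g i k) = g i i + (\<Sum>k\<in>- J. g i k)" using i by simp
    also have "g i i = A i (Q i (\<omega> J))"
      using i by (simp add: g_def koszul_sign_remove koszul_sign_square insert_absorb)
    finally show "koszul_sign i J *\<^sub>R A i (koszul_homotopy Q \<omega> (J - {i})) =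
      A i (Q i (\<omega> J)) + (\<Sum>k\<in>- J. g i k)" .
  qed
  moreover have "koszul_homotopy Q (koszul_diff A \<omega>) J =
      (\<Sum>k\<in>- J. A k (Q k (\<omega> J)) + (\<Sum>i\<in>J. - g i k))"
    unfolding koszul_homotopy_def
  proof (rule sum.cong[OF refl])
    fix k assume k: "k \<in> - J"
    have "koszul_sign k J *\<^sub>R Q k (koszul_diff A \<omega> (insert k J)) =
        (\<Sum>i\<in>insert k J. (koszul_sign k J * koszul_sign i (insert k J)) *\<^sub>R Q k (A i (\<omega> (insert k J - {i}))))"
      by (simp only: koszul_diff_eq linear_sum[OF Q] linear_scale[OF Q] scaleR_sum_right scaleR_scaleR)
    also have "\<dots> = (koszul_sign k J * koszul_sign k (insert k J)) *\<^sub>R Q k (A k (\<omega> (insert k J - {k}))) +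
        (\<Sum>i\<in>J. (koszul_sign k J * koszul_sign i (insert k J)) *\<^sub>R Q k (A i (\<omega> (insert k J - {i}))))"
      using k by (subst sum.insert) auto
    also have "(koszul_sign k J * koszul_sign k (insert k J)) *\<^sub>R Q k (A k (\<omega> (insert k J - {k}))) =
        A k (Q k (\<omega> J))"
      using k by (simp add: koszul_sign_insert koszul_sign_square comm)
    also have "(\<Sum>i\<in>J. (koszul_sign k J * koszul_sign i (insert k J)) *\<^sub>R Q k (A i (\<omega> (insert k J - {i})))) =
        (\<Sum>i\<in>J. - g i k)"
    proof (rule sum.cong[OF refl])
      fix i assume i: "i \<in> J"
      then have ik: "i \<noteq> k" using k by auto
      have "insert k J - {i} = insert k (J - {i})" using ik by auto
      moreover have "koszul_sign k J * koszul_sign i (insert k J) = - (koszul_sign i J * koszul_sign k (J - {i}))"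
        using i k ik by (auto simp: koszul_sign_insert koszul_sign_remove)
      ultimately show "(koszul_sign k J * koszul_sign i (insert k J)) *\<^sub>R Q k (A i (\<omega> (insert k J - {i}))) = - g i k"
        by (simp add: g_def comm)
    qed
    finally show "koszul_sign k J *\<^sub>R Q k (koszul_diff A \<omega> (insert k J)) =
        A k (Q k (\<omega> J)) + (\<Sum>i\<in>J. - g i k)" .
  qed
  moreover have "(\<Sum>k\<in>- J. \<Sum>i\<in>J. - g i k) = - (\<Sum>i\<in>J. \<Sum>k\<in>- J. g i k)"
    by (subst sum.swap) (simp add: sum_negf)
  moreover have "(\<Sum>i\<in>UNIV. A i (Q i (\<omega> J))) = (\<Sum>i\<in>J. A i (Q i (\<omega> J))) + (\<Sum>i\<in>- J. A i (Q i (\<omega> J)))"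
    using sum.union_disjoint[of J "- J" "\<lambda>i. A i (Q i (\<omega> J))"] by simp
  ultimately show ?thesis by (simp add: sum.distrib)
qed

text \<open>By the homotopy formula, \<open>Y\<close> maps a cocycle to the differential of its
  contraction. \<open>Y\<close> commutes with the \<open>A i\<close>, hence so does its inverse
  \<open>W\<close>, which therefore commutes with the differential and can be moved onto the
  primitive.\<close>

lemma koszul_exact_of_bij_combination:
  fixes A Q :: "'d::{finite,linorder} \<Rightarrow> 'b::real_vector \<Rightarrow> 'b"
  assumes A: "\<And>i. linear (A i)" and Q: "\<And>i. linear (Q i)"
    and commA: "\<And>i j x. A i (A j x) = A j (A i x)"
    and comm: "\<And>i j x. Q i (A j x) = A j (Q i x)"
    and bij: "bij (\<lambda>x. \<Sum>i\<in>UNIV. A i (Q i x))"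
  shows "koszul_exact A"
proof -
  define Y where "Y = (\<lambda>x. \<Sum>i\<in>UNIV. A i (Q i x))"
  have linY: "linear Y"
    unfolding Y_def by (intro linear_compose_sum ballI linear_compose[OF Q A, unfolded comp_def])
  have YA: "Y (A j x) = A j (Y x)" for j x
    by (simp add: Y_def comm commA[of _ j] linear_sum[OF A])
  define W where "W = inv Y"
  have bijY: "bij Y" using bij by (simp add: Y_def)
  have YW: "Y (W x) = x" and WY: "W (Y x) = x" for x
    using bijY by (simp_all add: W_def bij_is_surj surj_f_inv_f bij_is_inj)
  have linW: "linear W"
  proof (rule linearI)
    show "W (x + y) = W x + W y" for x y
      by (metis YW WY linear_add[OF linY])
    show "W (c *\<^sub>R x) = c *\<^sub>R W x" for c x
      by (metis YW WY linear_scale[OF linY])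
  qed
  have WA: "W (A j x) = A j (W x)" for j x
    by (metis YW WY YA)
  note zero = linear_0[OF A] linear_0[OF Q] linear_0[OF linW]
  have homotopy: "koszul_diff A (koszul_homotopy Q \<omega>) J + koszul_homotopy Q (koszul_diff A \<omega>) J = Y (\<omega> J)" for \<omega> J
    unfolding Y_def by (rule koszul_homotopy_formula[OF A Q comm])
  have h0: "koszul_homotopy Q (\<lambda>_. 0) = (\<lambda>_. 0)"
    by (simp add: koszul_homotopy_def fun_eq_iff zero)
  have d0: "koszul_diff A (\<lambda>_. 0) = (\<lambda>_. 0)"
    by (simp add: koszul_diff_def fun_eq_iff zero)
  show ?thesis
    unfolding koszul_exact_def
  proof (intro allI)
    fix k
    show "{\<omega> \<in> koszul_space k. koszul_diff A \<omega> = (\<lambda>_. 0)} =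
      (case k of 0 \<Rightarrow> {\<lambda>_. 0} | Suc l \<Rightarrow> koszul_diff A ` koszul_space l)"
    proof (cases k)
      case 0
      have "\<omega> = (\<lambda>_. 0)" if \<omega>: "\<omega> \<in> koszul_space 0" "koszul_diff A \<omega> = (\<lambda>_. 0)" for \<omega>
      proof
        fix J
        \<comment> \<open>The contraction reads \<open>\<omega>\<close> only at nonempty sets, where
          an element of degree 0 vanishes.\<close>
        have "koszul_homotopy Q \<omega> = (\<lambda>_. 0)"
          using \<omega>(1) by (simp add: koszul_homotopy_def koszul_space_def fun_eq_iff card_insert_if zero)
        then have "Y (\<omega> J) = 0" using homotopy[of \<omega> J] by (simp add: \<omega>(2) h0 d0)
        then show "\<omega> J = 0" using WY[of "\<omega> J"] by (simp add: zero)
      qed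
      then show ?thesis using d0 by (auto simp: 0 koszul_space_def)
    next
      case (Suc l)
      have "\<omega> \<in> koszul_diff A ` koszul_space l"
        if \<omega>: "\<omega> \<in> koszul_space (Suc l)" "koszul_diff A \<omega> = (\<lambda>_. 0)" for \<omega>
      proof
        let ?\<eta> = "\<lambda>I. W (koszul_homotopy Q \<omega> I)"
        show "?\<eta> \<in> koszul_space l"
          using \<omega>(1) by (auto simp: koszul_space_def koszul_homotopy_def card_insert_if zero intro!: sum.neutral)
        show "\<omega> = koszul_diff A ?\<eta>"
        proof
          fix J
          have "koszul_diff A ?\<eta> J = W (koszul_diff A (koszul_homotopy Q \<omega>) J)"
            by (simp add: koszul_diff_def linear_sum[OF linW] linear_scale[OF linW] WA)
          also have "\<dots> = W (Y (\<omega> J))" using homotopy[of \<omega> J] by (simp add: \<omega>(2) h0)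
          finally show "\<omega> J = koszul_diff A ?\<eta> J" by (simp add: WY)
        qed
      qed
      moreover have "koszul_diff A \<omega> \<in> koszul_space (Suc l)" if "\<omega> \<in> koszul_space l" for \<omega> :: "'d set \<Rightarrow> 'b"
      proof -
        have "koszul_diff A \<omega> J = 0" if J: "card J \<noteq> Suc l" for J
          unfolding koszul_diff_def
        proof (intro sum.neutral ballI)
          fix i assume "i \<in> J"
          then have "card (J - {i}) \<noteq> l" using J card_Suc_Diff1[of J i] by simp
          then have "\<omega> (J - {i}) = 0" using \<open>\<omega> \<in> koszul_space l\<close> by (auto simp: koszul_space_def)
          then show "(- 1) ^ card {j \<in> J. j < i} *\<^sub>R A i (\<omega> (J - {i})) = 0" by (simp add: zero)
        qed
        then show ?thesis by (simp add: koszul_space_def)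
      qed
      moreover have "koszul_diff A (koszul_diff A \<omega>) = (\<lambda>_. 0)" for \<omega>
        using koszul_diff_koszul_diff[of A, OF A commA] by (simp add: fun_eq_iff)
      ultimately show ?thesis by (auto simp: Suc)
    qed
  qed
qed

section \<open>Operators with closed range\<close>

instance chilbert_space \<subseteq> banach ..

text \<open>The open mapping argument onto the closed range: by Baire, the closure of the image of
  some ball has interior in the range, and successive approximation turns this into preimages of
  controlled norm, which are unique by injectivity.\<close>

lemma bounded_below_of_closed_range:
  fixes f :: "'a::banach \<Rightarrow> 'b::banach"
  assumes f: "bounded_linear f" and inj: "inj f" and closed: "closed (range f)"
  obtains M where "\<And>x. norm x \<le> M * norm (f x)"
proof -
  interpret f: bounded_linear f by (rule f)
  define Z where "Z = range f"
  define F where "F = (\<lambda>n::nat. closure (f ` cball 0 (real n)))"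
  have closedZ: "closed Z" using closed by (simp add: Z_def)
  have FZ: "F n \<subseteq> Z" for n
    unfolding F_def by (rule closure_minimal[OF _ closedZ]) (auto simp: Z_def)
  have Union: "(\<Union>n. F n) = Z"
  proof
    show "(\<Union>n. F n) \<subseteq> Z" using FZ by blast
    show "Z \<subseteq> (\<Union>n. F n)"
    proof
      fix z assume "z \<in> Z"
      then obtain x where x: "z = f x" by (auto simp: Z_def)
      obtain n :: nat where "norm x \<le> n" using real_arch_simple by blast
      then have "z \<in> f ` cball 0 (real n)" using x by simp
      then have "z \<in> F n" unfolding F_def by (rule subsetD[OF closure_subset])
      then show "z \<in> (\<Union>n. F n)" by blast
    qed
  qed
  have "\<exists>n. top_of_set Z interior_of F n \<noteq> {}"
  proof (rule ccontr)
    assume *: "\<not> ?thesis"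
    \<comment> \<open>If every \<open>F n\<close> had empty interior in \<open>Z\<close>, so would
      their union \<open>Z\<close>; but \<open>Z\<close> is open in itself and nonempty.\<close>
    have "top_of_set Z interior_of \<Union>(range F) = {}"
    proof (rule Baire_category_alt)
      show "completely_metrizable_space (top_of_set Z) \<or> locally_compact_space (top_of_set Z) \<and> regular_space (top_of_set Z)"
        by (rule disjI1, rule completely_metrizable_space_closedin[OF completely_metrizable_space_euclidean])
          (rule closedZ[unfolded closed_closedin])
      fix T assume "T \<in> range F"
      then show "closedin (top_of_set Z) T \<and> top_of_set Z interior_of T = {}"
        using * closed_subset[OF FZ] unfolding F_def by blast
    qed simp
    moreover have "top_of_set Z interior_of Z = Z"
      using interior_of_topspace[of "top_of_set Z"] by simp
    ultimately have "Z = {}" by (simp only: Union)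
    then show False by (simp add: Z_def)
  qed
  then obtain n z0 where "z0 \<in> top_of_set Z interior_of F n" by blast
  then obtain U where U: "openin (top_of_set Z) U" "z0 \<in> U" "U \<subseteq> F n"
    unfolding interior_of_def by blast
  then obtain r where r: "r > 0" "ball z0 r \<inter> Z \<subseteq> U"
    unfolding openin_contains_ball by blast
  have z0: "z0 \<in> Z" "z0 \<in> F n" using U FZ by auto
  \<comment> \<open>A small \<open>z\<close> in \<open>Z\<close> is the difference of
    \<open>z0 + z\<close> and \<open>z0\<close>, both in \<open>F n\<close>. Subtracting their
    approximate preimages accounts for the radius \<open>2 * n\<close>.\<close>
  have approx0: "\<exists>x. norm x \<le> 2 * n \<and> norm (z - f x) < e" if z: "z \<in> Z" "norm z < r" and e: "e > 0" for z e
  proof -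
    have "z0 + z \<in> Z" using z z0(1) by (auto simp: Z_def simp flip: f.add)
    moreover have "z0 + z \<in> ball z0 r" using z by (simp add: dist_norm)
    ultimately have "z0 + z \<in> F n" using r U by blast
    then have "\<exists>y\<in>f ` cball 0 (real n). dist y (z0 + z) < e / 2"
      unfolding F_def closure_approachable using half_gt_zero[OF e] by blast
    then obtain x where x: "norm x \<le> n" "dist (f x) (z0 + z) < e / 2" by auto
    have "\<exists>y\<in>f ` cball 0 (real n). dist y z0 < e / 2"
      using z0(2) half_gt_zero[OF e] unfolding F_def closure_approachable by blast
    then obtain y where y: "norm y \<le> n" "dist (f y) z0 < e / 2" by auto
    have "z - f (x - y) = (f y - z0) - (f x - (z0 + z))" by (simp add: f.diff)
    then have "norm (z - f (x - y)) \<le> norm (f y - z0) + norm (f x - (z0 + z))"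
      by (simp only: norm_triangle_ineq4)
    also have "\<dots> < e" using x(2) y(2) by (simp add: dist_norm)
    finally have "norm (z - f (x - y)) < e" .
    moreover have "norm (x - y) \<le> 2 * n" using norm_triangle_ineq4[of x y] x(1) y(1) by simp
    ultimately show ?thesis by blast
  qed
  \<comment> \<open>A nonzero \<open>z\<close> is scaled to norm \<open>r / 2\<close>, where
    preimages of norm at most \<open>2 * n\<close> are available.\<close>
  define M where "M = 4 * n / r"
  have "M \<ge> 0" using r by (simp add: M_def)
  have approx: "\<exists>x. norm x \<le> M * norm z \<and> norm (z - f x) \<le> norm z / 2" if z: "z \<in> Z" for z
  proof (cases "z = 0")
    case True
    then show ?thesis by (intro exI[of _ 0]) (simp add: f.zero)
  next
    case False
    define t where "t = r / (2 * norm z)"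
    have t: "t > 0" using False r by (simp add: t_def)
    have tz: "norm (t *\<^sub>R z) < r" using False r t by (simp add: t_def)
    have "t *\<^sub>R z \<in> Z" using z by (auto simp: Z_def simp flip: f.scaleR)
    then obtain x where x: "norm x \<le> 2 * n" "norm (t *\<^sub>R z - f x) < t * norm z / 2"
      using approx0[OF _ tz, of "t * norm z / 2"] t False by auto
    let ?x = "(1 / t) *\<^sub>R x"
    have "norm ?x = norm x / t" using t by simp
    also have "\<dots> \<le> 2 * n / t" using x(1) t by (simp add: divide_right_mono)
    also have "\<dots> = M * norm z" using r False by (simp add: t_def M_def)
    finally have 1: "norm ?x \<le> M * norm z" .
    have "z - f ?x = (1 / t) *\<^sub>R (t *\<^sub>R z - f x)"
      using t by (simp add: f.scaleR scaleR_diff_right)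
    then have "norm (z - f ?x) = norm (t *\<^sub>R z - f x) / t" using t by simp
    also have "\<dots> \<le> (t * norm z / 2) / t" using x(2) t by (intro divide_right_mono) auto
    finally have "norm (z - f ?x) \<le> norm z / 2" using t by simp
    with 1 show ?thesis by blast
  qed
  then obtain g where g: "\<And>z. z \<in> Z \<Longrightarrow> norm (g z) \<le> M * norm z"
    "\<And>z. z \<in> Z \<Longrightarrow> norm (z - f (g z)) \<le> norm z / 2" by metis
  have "norm u \<le> 2 * M * norm (f u)" for u
  proof -
    \<comment> \<open>The successive residuals, starting at \<open>f u\<close> and at least halved
      in norm each time. The corrections \<open>g (z k)\<close> sum to a preimage of
      \<open>f u\<close>, that is, to \<open>u\<close>; the geometric series gives the factor
      2.\<close>
    define z where "z = (\<lambda>k. ((\<lambda>y. y - f (g y)) ^^ k) (f u))"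
    have z_0: "z 0 = f u" and z_Suc: "z (Suc k) = z k - f (g (z k))" for k
      by (simp_all add: z_def)
    have zZ: "z k \<in> Z" for k
      by (induction k) (auto simp: z_0 z_Suc Z_def simp flip: f.diff)
    have z_le: "norm (z k) \<le> norm (f u) * (1 / 2) ^ k" for k
    proof (induction k)
      case (Suc k)
      then show ?case using g(2)[OF zZ[of k]] by (simp add: z_Suc)
    qed (simp add: z_0)
    have gz_le: "norm (g (z k)) \<le> M * norm (f u) * (1 / 2) ^ k" for k
      using g(1)[OF zZ[of k]] mult_left_mono[OF z_le[of k] \<open>M \<ge> 0\<close>] by simp
    have sums: "(\<lambda>k. M * norm (f u) * (1 / 2) ^ k) sums (M * norm (f u) * 2)"
      by (rule sums_mult) (use geometric_sums[of "1 / 2 :: real"] in simp)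
    then have abs_summable: "summable (\<lambda>k. norm (g (z k)))"
      by (intro summable_comparison_test'[OF sums_summable[OF sums]]) (simp add: gz_le)
    then have summable: "summable (\<lambda>k. g (z k))" by (rule summable_norm_cancel)
    have "(\<Sum>k<m. f (g (z k))) = f u - z m" for m
      by (induction m) (simp_all add: z_0 z_Suc)
    moreover have "(\<lambda>m. f u - z m) \<longlonglongrightarrow> f u"
    proof -
      have "(\<lambda>m. norm (f u) * (1 / 2) ^ m) \<longlonglongrightarrow> 0"
        by (intro tendsto_mult_right_zero LIMSEQ_power_zero) simp
      then have "z \<longlonglongrightarrow> 0" by (rule Lim_null_comparison[rotated]) (simp add: z_le)
      then show ?thesis using tendsto_diff[OF tendsto_const, of z 0 sequentially "f u"] by simp
    qed
    ultimately have "(\<lambda>k. f (g (z k))) sums f u" by (simp add: sums_def)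
    then have "f u = f (suminf (\<lambda>k. g (z k)))"
      by (rule sums_unique2) (rule f.sums[OF summable_sums[OF summable]])
    then have "u = suminf (\<lambda>k. g (z k))" using inj by (simp add: inj_eq)
    then have "norm u \<le> suminf (\<lambda>k. norm (g (z k)))" using summable_norm[OF abs_summable] by simp
    also have "\<dots> \<le> suminf (\<lambda>k. M * norm (f u) * (1 / 2) ^ k)"
      by (intro suminf_le gz_le abs_summable sums_summable[OF sums])
    also have "\<dots> = M * norm (f u) * 2" using sums by (rule sums_unique[symmetric])
    finally show ?thesis by simp
  qed
  then show ?thesis using that by blast
qed

section \<open>Exactness in degrees 0 and 1\<close>

lemma koszul_exact_imp_kernel_trivial:
  fixes A :: "'d::{finite,linorder} \<Rightarrow> 'a::real_vector \<Rightarrow> 'a"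
  assumes exact: "koszul_exact A" and lin: "\<And>i. linear (A i)" and x: "\<And>i. A i x = 0"
  shows "x = 0"
proof -
  let ?\<omega> = "\<lambda>J :: 'd set. if J = {} then x else 0"
  \<comment> \<open>The differential of this element of degree 0 has the coefficients
    \<open>A i x\<close> at the singletons \<open>{i}\<close>.\<close>
  have "koszul_diff A ?\<omega> = (\<lambda>_. 0)"
    by (auto simp: koszul_diff_def fun_eq_iff x linear_0[OF lin] intro!: sum.neutral)
  then have "?\<omega> \<in> {\<omega> \<in> koszul_space 0. koszul_diff A \<omega> = (\<lambda>_. 0)}"
    by (auto simp: koszul_space_def)
  also have "\<dots> = {\<lambda>_. 0}"
    using exact unfolding koszul_exact_def by (metis old.nat.simps(4))
  finally have "?\<omega> = (\<lambda>_. 0)" by simp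
  from fun_cong[OF this, of "{}"] show ?thesis by simp
qed

text \<open>The tuple \<open>y\<close> is encoded as an element of degree 1 with coefficient
  \<open>y i\<close> at \<open>{i}\<close>. The symmetry condition says that its differential
  vanishes at every two-element set, so exactness makes it a differential; the preimage has degree
  0, and \<open>x\<close> is its coefficient at the empty set.\<close>

lemma koszul_exact_imp_solvable:
  fixes A :: "'d::{finite,linorder} \<Rightarrow> 'a::real_vector \<Rightarrow> 'a"
  assumes exact: "koszul_exact A" and lin: "\<And>i. linear (A i)"
    and y: "\<And>i j. A i (y j) = A j (y i)"
  obtains x where "\<And>i. A i x = y i"
proof -
  let ?\<omega> = "\<lambda>J :: 'd set. if card J = 1 then y (the_elem J) else 0"
  have "koszul_diff A ?\<omega> J = 0" for J
  proof (cases "card J = 2")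
    case False
    then have "card (J - {i}) \<noteq> 1" if "i \<in> J" for i using that card_Suc_Diff1[of J i] by simp
    then show ?thesis by (auto simp: koszul_diff_def linear_0[OF lin] intro!: sum.neutral)
  next
    case True
    then obtain i j where J: "J = {i, j}" "i < j"
      by (auto simp: card_2_iff) (metis insert_commute linorder_neqE)
    have *: "J - {i} = {j}" "J - {j} = {i}" "{k \<in> J. k < i} = {}" "{k \<in> J. k < j} = {i}"
      using J by auto
    have "koszul_diff A ?\<omega> J = (- 1) ^ card {k \<in> J. k < i} *\<^sub>R A i (?\<omega> (J - {i})) +
        (- 1) ^ card {k \<in> J. k < j} *\<^sub>R A j (?\<omega> (J - {j}))"
      unfolding koszul_diff_def using J by (subst (1) J(1)) simp
    also have "\<dots> = A i (y j) - A j (y i)" unfolding * by simp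
    finally have "koszul_diff A ?\<omega> J = A i (y j) - A j (y i)" .
    then show ?thesis by (simp add: y)
  qed
  then have "?\<omega> \<in> {\<omega> \<in> koszul_space 1. koszul_diff A \<omega> = (\<lambda>_. 0)}"
    by (auto simp: koszul_space_def)
  also have "\<dots> = koszul_diff A ` koszul_space 0"
    using exact unfolding koszul_exact_def by (metis One_nat_def old.nat.simps(5))
  finally obtain \<eta> where \<eta>: "?\<omega> = koszul_diff A \<eta>" by blast
  have "A i (\<eta> {}) = y i" for i
  proof -
    have "y i = (- 1) ^ card {j \<in> {i}. j < i} *\<^sub>R A i (\<eta> ({i} - {i}))"
      using fun_cong[OF \<eta>, of "{i}"] by (simp add: koszul_diff_def)
    also have "{j \<in> {i}. j < i} = {}" by auto
    finally show ?thesis by simp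
  qed
  then show ?thesis using that by blast
qed

text \<open>Exactness in degree 0 makes \<open>x \<mapsto> (A i x)\<close> injective. Exactness in
  degree 1 identifies its range with the solutions of \<open>A i (y j) = A j (y i)\<close>, a closed
  set by continuity.\<close>

lemma koszul_exact_imp_bounded_below:
  fixes A :: "'d::{finite,linorder} \<Rightarrow> 'a::banach \<Rightarrow> 'a"
  assumes exact: "koszul_exact A" and A: "\<And>i. bounded_linear (A i)"
    and comm: "\<And>i j x. A i (A j x) = A j (A i x)"
  obtains M where "\<And>x. norm x \<le> M * (\<Sum>i\<in>UNIV. norm (A i x))"
proof -
  note lin = bounded_linear.linear[OF A]
  define f where "f = (\<lambda>x. \<chi> i. A i x)"
  have norm_f: "norm (f x) \<le> (\<Sum>i\<in>UNIV. norm (A i x))" for x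
    using L2_set_le_sum[of UNIV "\<lambda>i. norm (f x $ i)"] by (simp add: norm_vec_def f_def)
  have bl: "bounded_linear f"
  proof (rule bounded_linear_intro)
    show "f (x + y) = f x + f y" for x y by (simp add: f_def vec_eq_iff linear_add[OF lin])
    show "f (r *\<^sub>R x) = r *\<^sub>R f x" for r x by (simp add: f_def vec_eq_iff linear_scale[OF lin])
    show "norm (f x) \<le> norm x * (\<Sum>i\<in>UNIV. onorm (A i))" for x
    proof -
      have "(\<Sum>i\<in>UNIV. norm (A i x)) \<le> (\<Sum>i\<in>UNIV. norm x * onorm (A i))"
        using onorm[OF A] by (intro sum_mono) (simp add: mult.commute)
      then show ?thesis using norm_f[of x] by (simp add: sum_distrib_left)
    qed
  qed
  have inj: "inj f"
  proof (rule injI)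
    fix x y assume "f x = f y"
    then have "A i (x - y) = 0" for i by (simp add: f_def vec_eq_iff linear_diff[OF lin])
    then show "x = y" using koszul_exact_imp_kernel_trivial[OF exact lin, of "x - y"] by simp
  qed
  have "range f = (\<Inter>i. \<Inter>j. {y. A i (y $ j) = A j (y $ i)})"
  proof (intro equalityI subsetI)
    fix y assume "y \<in> (\<Inter>i. \<Inter>j. {y. A i (y $ j) = A j (y $ i)})"
    then obtain x where "\<And>i. A i x = y $ i"
      using koszul_exact_imp_solvable[OF exact lin, of "($) y"] by auto
    then have "y = f x" by (simp add: f_def vec_eq_iff)
    then show "y \<in> range f" by blast
  qed (auto simp: f_def comm)
  moreover have "closed (\<Inter>i. \<Inter>j. {y. A i (y $ j) = A j (y $ i)})"
    by (intro closed_INT ballI closed_Collect_eq bounded_linear.continuous_on[OF A] continuous_intros)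
  ultimately have "closed (range f)" by simp
  then obtain M where M: "\<And>x. norm x \<le> M * norm (f x)"
    using bounded_below_of_closed_range[OF bl inj] by blast
  \<comment> \<open>A nonnegative constant is needed in order to replace \<open>norm (f x)\<close>
    by the larger sum.\<close>
  have "norm x \<le> max M 0 * (\<Sum>i\<in>UNIV. norm (A i x))" for x
  proof -
    have "norm x \<le> max M 0 * norm (f x)" using M[of x] by (meson max.cobounded1 mult_right_mono norm_ge_zero order.trans)
    also have "\<dots> \<le> max M 0 * (\<Sum>i\<in>UNIV. norm (A i x))" by (intro mult_left_mono norm_f) auto
    finally show ?thesis .
  qed
  then show ?thesis using that by blast
qed

section \<open>Spectral inclusion\<close>

text \<open>Solving \<open>x - X x = y\<close> amounts to finding the fixed point of the contraction
  \<open>x \<mapsto> y + X x\<close>.\<close>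

lemma bij_one_minus_contraction:
  fixes X :: "'a::banach \<Rightarrow> 'a"
  assumes X: "bounded_linear X" and small: "onorm X < 1"
  shows "bij (\<lambda>x. x - X x)"
proof -
  have "\<exists>!x. y + X x = x" for y
  proof (rule banach_fix_type[OF onorm_pos_le[OF X] small], intro allI)
    fix x x'
    have "y + X x - (y + X x') = X (x - x')"
      using linear_diff[OF bounded_linear.linear[OF X], of x x'] by simp
    then show "dist (y + X x) (y + X x') \<le> onorm X * dist x x'"
      using onorm[OF X, of "x - x'"] by (simp only: dist_norm)
  qed
  then have "\<exists>!x. x - X x = y" for y
    by (simp only: diff_eq_eq eq_commute[of "_ + _"])
  then show ?thesis unfolding bij_iff by blast
qed

text \<open>As \<open>1 - p^n\<close> vanishes at \<open>l\<close>, it lies in the ideal of the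
  \<open>X i - l i\<close>. Its value at \<open>T\<close> is invertible, and the ideal coefficients
  at \<open>T\<close> serve as the contraction operators.\<close>

lemma koszul_exact_of_onorm_power_less_1:
  fixes T :: "'d::{finite,linorder} \<Rightarrow> 'b::chilbert_space \<Rightarrow> 'b"
  assumes T: "commuting_bounded_tuple T" and p_l: "poly_eval p l = 1"
    and small: "onorm (poly_op (p ^ n) T) < 1"
  shows "koszul_exact (\<lambda>i x. T i x - (l $ i) *\<^sub>C x)"
proof -
  obtain q where q: "p ^ n - cpoly_const (poly_eval (p ^ n) l) = (\<Sum>i\<in>UNIV. q i * (cpoly_var i - cpoly_const (l $ i)))"
    using cpoly_minus_value_in_ideal by blast
  define v where "v = (\<lambda>i. cpoly_var i - cpoly_const (l $ i))"
  have v: "poly_op (v i) T = (\<lambda>x. T i x - (l $ i) *\<^sub>C x)" for i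
    by (simp add: fun_eq_iff v_def poly_op_diff poly_op_var poly_op_const)
  \<comment> \<open>The ideal representation was obtained for \<open>p^n - 1\<close>, hence the sign
    of the coefficients.\<close>
  have "1 - p ^ n = (\<Sum>i\<in>UNIV. v i * - q i)"
    using q by (simp add: poly_eval_power p_l v_def sum_negf mult.commute minus_diff_eq[symmetric, of 1])
  then have "poly_op (1 - p ^ n) T x = (\<Sum>i\<in>UNIV. poly_op (v i) T (poly_op (- q i) T x))" for x
    by (simp only: poly_op_sum poly_op_mult[OF T])
  then have combination: "(\<Sum>i\<in>UNIV. poly_op (v i) T (poly_op (- q i) T x)) = x - poly_op (p ^ n) T x" for x
    by (simp add: poly_op_diff)
  note lin = bounded_linear.linear[OF bounded_clinearD(1)[OF bounded_clinear_poly_op[OF T]]]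
  have comm: "poly_op f T (poly_op g T x) = poly_op g T (poly_op f T x)" for f g x
    by (simp only: poly_op_mult[OF T, symmetric] mult.commute)
  have "koszul_exact (\<lambda>i. poly_op (v i) T)"
  proof (rule koszul_exact_of_bij_combination[where Q = "\<lambda>i. poly_op (- q i) T"])
    show "bij (\<lambda>x. \<Sum>i\<in>UNIV. poly_op (v i) T (poly_op (- q i) T x))"
      unfolding combination
      by (rule bij_one_minus_contraction[OF bounded_clinearD(1)[OF bounded_clinear_poly_op[OF T]] small])
  qed (rule lin comm)+
  then show ?thesis by (simp only: v)
qed

text \<open>Off the spectrum, \<open>S - l\<close> is bounded below, so \<open>norm (b(S) x)\<close>
  is at most a constant times the sum of the \<open>norm ((S i - l i) b(S) x)\<close>. With small
  \<open>e\<close> this forces \<open>b(S)\<close> to have norm at most 1/2 rather than 1.\<close>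

lemma taylor_spectrum_of_approx_null:
  fixes S :: "'d::{finite,linorder} \<Rightarrow> 'a::chilbert_space \<Rightarrow> 'a"
  assumes S: "commuting_bounded_tuple S"
    and approx: "\<And>e. e > 0 \<Longrightarrow> \<exists>b. onorm (poly_op b S) = 1 \<and>
      (\<forall>i. onorm (poly_op ((cpoly_var i - cpoly_const (l $ i)) * b) S) \<le> e)"
  shows "l \<in> taylor_spectrum S"
proof (rule ccontr)
  assume "l \<notin> taylor_spectrum S"
  then have exact: "koszul_exact (\<lambda>i x. S i x - (l $ i) *\<^sub>C x)"
    by (simp add: taylor_spectrum_def)
  note bl = bounded_clinearD(1)[OF bounded_clinear_poly_op[OF S]]
  have v: "poly_op (cpoly_var i - cpoly_const (l $ i)) S = (\<lambda>x. S i x - (l $ i) *\<^sub>C x)" for i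
    by (simp add: fun_eq_iff poly_op_diff poly_op_var poly_op_const)
  have comm: "poly_op f S (poly_op g S x) = poly_op g S (poly_op f S x)" for f g x
    by (simp only: poly_op_mult[OF S, symmetric] mult.commute)
  obtain M where M: "\<And>x. norm x \<le> M * (\<Sum>i\<in>UNIV. norm (poly_op (cpoly_var i - cpoly_const (l $ i)) S x))"
    using koszul_exact_imp_bounded_below[OF exact[folded v] bl comm] by blast
  \<comment> \<open>The total constant after bounding each of the \<open>d\<close> summands by
    \<open>e * norm x\<close>; the choice \<open>e = 1 / (2 * (C + 1))\<close> then gives
    \<open>C * e \<le> 1/2\<close>.\<close>
  define C where "C = \<bar>M\<bar> * card (UNIV :: 'd set)"
  have "C \<ge> 0" by (simp add: C_def)
  then have "1 / (2 * (C + 1)) > 0" by simp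
  then obtain b where b: "onorm (poly_op b S) = 1"
    "\<And>i. onorm (poly_op ((cpoly_var i - cpoly_const (l $ i)) * b) S) \<le> 1 / (2 * (C + 1))"
    using approx by blast
  have "onorm (poly_op b S) \<le> 1 / 2"
  proof (rule onorm_bound)
    fix x
    have "norm (poly_op (cpoly_var i - cpoly_const (l $ i)) S (poly_op b S x)) \<le> 1 / (2 * (C + 1)) * norm x" for i
      using order.trans[OF onorm[OF bl] mult_right_mono[OF b(2)[of i] norm_ge_zero]]
      by (simp only: poly_op_mult[OF S, symmetric])
    then have "(\<Sum>i\<in>UNIV. norm (poly_op (cpoly_var i - cpoly_const (l $ i)) S (poly_op b S x))) \<le>
        card (UNIV :: 'd set) * (1 / (2 * (C + 1)) * norm x)"
      by (rule sum_bounded_above)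
    then have "\<bar>M\<bar> * (\<Sum>i\<in>UNIV. norm (poly_op (cpoly_var i - cpoly_const (l $ i)) S (poly_op b S x))) \<le>
        C * (1 / (2 * (C + 1)) * norm x)"
      unfolding C_def mult.assoc by (intro mult_left_mono) auto
    moreover have "norm (poly_op b S x) \<le>
        \<bar>M\<bar> * (\<Sum>i\<in>UNIV. norm (poly_op (cpoly_var i - cpoly_const (l $ i)) S (poly_op b S x)))"
      by (rule order.trans[OF M mult_right_mono[OF abs_ge_self]]) (simp add: sum_nonneg)
    ultimately have "norm (poly_op b S x) \<le> C * (1 / (2 * (C + 1)) * norm x)" by linarith
    also have "\<dots> = C / (C + 1) * (norm x / 2)" by simp
    also have "\<dots> \<le> 1 * (norm x / 2)" using \<open>C \<ge> 0\<close> by (intro mult_right_mono) auto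
    finally show "norm (poly_op b S x) \<le> 1 / 2 * norm x" by simp
  qed simp
  with b(1) show False by simp
qed

text \<open>By \<open>ex_power_less_1\<close> it suffices that no \<open>p - c\<close> with
  \<open>|c| \<ge> 1\<close> is a topological divisor of zero. Such a divisor would extend to a
  joint one with the \<open>X i - l i\<close> for some \<open>l\<close> in the spectrum; common
  witnesses then give \<open>p(l) = c\<close>, against \<open>|p(l)| < 1\<close>.\<close>

lemma ex_onorm_power_less_1:
  fixes S :: "'d::{finite,linorder} \<Rightarrow> 'a::chilbert_space \<Rightarrow> 'a"
  assumes S: "commuting_bounded_tuple S"
    and p: "\<And>l. l \<in> taylor_spectrum S \<Longrightarrow> cmod (poly_eval p l) < 1"
  shows "\<exists>n>0. onorm (poly_op (p ^ n) S) < 1"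
proof (cases "\<exists>x::'a. x \<noteq> 0")
  \<comment> \<open>On the zero space the seminorm of 1 is not 1, so this case is treated
    separately.\<close>
  case False
  then have "poly_op (p ^ 1) S = (\<lambda>_. 0)" by (auto simp: fun_eq_iff)
  then show ?thesis by (intro exI[of _ 1]) (simp add: onorm_zero)
next
  case True
  then obtain x0 :: 'a where "x0 \<noteq> 0" by blast
  interpret N: complex_seminormed_algebra cpoly_const "\<lambda>p. onorm (poly_op p S)"
    by (rule complex_seminormed_algebra_poly_op[OF S \<open>x0 \<noteq> 0\<close>])
  show ?thesis
  proof (rule N.ex_power_less_1)
    fix c assume c: "cmod c \<ge> 1"
    show "\<not> N.approx_null {p - cpoly_const c}"
    proof
      assume "N.approx_null {p - cpoly_const c}"
      then obtain L where L: "N.approx_null ({p - cpoly_const c} \<union>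
          (\<lambda>i. cpoly_var i - cpoly_const (L i)) ` (UNIV :: 'd set))"
        using N.approx_null_extend[of "UNIV :: 'd set" "{p - cpoly_const c}" cpoly_var] by auto
      define l where "l = (\<chi> i. L i)"
      have approx: "\<exists>b. onorm (poly_op b S) = 1 \<and> onorm (poly_op ((p - cpoly_const c) * b) S) \<le> e \<and>
          (\<forall>i. onorm (poly_op ((cpoly_var i - cpoly_const (l $ i)) * b) S) \<le> e)" if "e > 0" for e
      proof -
        obtain b where "onorm (poly_op b S) = 1" "\<forall>f\<in>{p - cpoly_const c} \<union>
          (\<lambda>i. cpoly_var i - cpoly_const (L i)) ` (UNIV :: 'd set). onorm (poly_op (f * b) S) \<le> e"
          using L \<open>e > 0\<close> unfolding N.approx_null_def by blast
        then show ?thesis by (intro exI[of _ b]) (auto simp: l_def)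
      qed
      then have "l \<in> taylor_spectrum S" by (intro taylor_spectrum_of_approx_null[OF S]) blast
      then have "cmod (poly_eval p l) < 1" by (rule p)
      obtain q where q: "p - cpoly_const (poly_eval p l) = (\<Sum>i\<in>UNIV. q i * (cpoly_var i - cpoly_const (l $ i)))"
        using cpoly_minus_value_in_ideal by blast
      \<comment> \<open>The summand 1 accounts for \<open>p - c\<close>, the sum for the ideal
        representation of \<open>p - p(l)\<close>.\<close>
      define K where "K = 1 + (\<Sum>i\<in>UNIV. onorm (poly_op (q i) S))"
      have "K > 0" unfolding K_def by (intro add_pos_nonneg sum_nonneg N.N_nonneg) simp
      have "cmod (poly_eval p l - c) \<le> K * e" if "e > 0" for e
      proof -
        obtain b where b: "onorm (poly_op b S) = 1" "onorm (poly_op ((p - cpoly_const c) * b) S) \<le> e"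
          "\<And>i. onorm (poly_op ((cpoly_var i - cpoly_const (l $ i)) * b) S) \<le> e"
          using approx[OF \<open>e > 0\<close>] by blast
        have "cpoly_const (poly_eval p l - c) * b = (p - cpoly_const c) * b - (p - cpoly_const (poly_eval p l)) * b"
          by (simp add: single_diff algebra_simps)
        also have "(p - cpoly_const (poly_eval p l)) * b = (\<Sum>i\<in>UNIV. q i * ((cpoly_var i - cpoly_const (l $ i)) * b))"
          unfolding q by (simp add: sum_distrib_right mult.assoc)
        finally have "cmod (poly_eval p l - c) = onorm (poly_op ((p - cpoly_const c) * b -
            (\<Sum>i\<in>UNIV. q i * ((cpoly_var i - cpoly_const (l $ i)) * b))) S)"
          using N.N_scale[of "poly_eval p l - c" b] b(1) by simp
        also have "\<dots> \<le> onorm (poly_op ((p - cpoly_const c) * b) S) +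
            onorm (poly_op (\<Sum>i\<in>UNIV. q i * ((cpoly_var i - cpoly_const (l $ i)) * b)) S)"
          by (rule N.N_diff)
        also have "\<dots> \<le> e + (\<Sum>i\<in>UNIV. onorm (poly_op (q i * ((cpoly_var i - cpoly_const (l $ i)) * b)) S))"
          by (intro add_mono b(2) N.N_sum)
        also have "\<dots> \<le> e + (\<Sum>i\<in>UNIV. onorm (poly_op (q i) S) * e)"
          by (intro add_left_mono sum_mono order.trans[OF N.N_mult] mult_left_mono b(3) N.N_nonneg)
        also have "\<dots> = K * e" by (simp add: K_def distrib_right sum_distrib_right)
        finally show ?thesis .
      qed
      then have "cmod (poly_eval p l - c) \<le> 0 + e" if "e > 0" for e
        using that \<open>K > 0\<close> by (metis add_0 divide_pos_pos less_irrefl nonzero_mult_div_cancel_left times_divide_eq_right)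
      then have "cmod (poly_eval p l - c) \<le> 0" by (rule field_le_epsilon)
      then have "poly_eval p l = c" by simp
      with \<open>cmod (poly_eval p l) < 1\<close> c show False by simp
    qed
  qed
qed

theorem lemma1p5:
  fixes S :: "'d::{finite,linorder} \<Rightarrow> 'a::chilbert_space \<Rightarrow> 'a"
    and T :: "'d \<Rightarrow> 'b::chilbert_space \<Rightarrow> 'b"
    and K :: "(complex ^ 'd::{finite,linorder}) set"
  assumes "commuting_bounded_tuple S"
    and "commuting_bounded_tuple T"
    and "poly_map_completely_contractive S T"
    and "polynomially_convex K"
    and "taylor_spectrum S \<subseteq> K"
  shows "taylor_spectrum T \<subseteq> K"
proof
  fix l assume l: "l \<in> taylor_spectrum T"
  show "l \<in> K"
  proof (rule ccontr)
    assume "l \<notin> K"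
    then have "l \<notin> polynomially_convex_hull K"
      using assms(4) by (auto simp: polynomially_convex_def)
    then obtain p where p: "(SUP w\<in>K. ennreal (cmod (poly_eval p w))) < ennreal (cmod (poly_eval p l))"
      by (auto simp: polynomially_convex_hull_def not_le)
    then have pl: "poly_eval p l \<noteq> 0" by auto
    have less: "cmod (poly_eval p w) < cmod (poly_eval p l)" if "w \<in> K" for w
      using order.strict_trans1[OF SUP_upper[OF that] p] by (simp add: ennreal_less_iff)
    \<comment> \<open>Dividing by \<open>p(l)\<close> gives value 1 at \<open>l\<close> and keeps
      the modulus below 1 at each point of \<open>K\<close>.\<close>
    define f where "f = cpoly_const (inverse (poly_eval p l)) * p"
    have f_l: "poly_eval f l = 1" using pl by (simp add: f_def poly_eval_mult)
    have f_less: "cmod (poly_eval f w) < 1" if "w \<in> taylor_spectrum S" for w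
    proof -
      have "w \<in> K" using that assms(5) by blast
      then show ?thesis
        using less[of w] pl
        by (simp only: f_def poly_eval_mult poly_eval_const norm_mult norm_inverse) (simp add: divide_simps)
    qed
    obtain n where "onorm (poly_op (f ^ n) S) < 1"
      using ex_onorm_power_less_1[OF assms(1) f_less] by blast
    then have "onorm (poly_op (f ^ n) T) < 1"
      using poly_map_completely_contractiveD[OF assms(3,1,2)] by (rule order.strict_trans1[rotated])
    then have "koszul_exact (\<lambda>i x. T i x - (l $ i) *\<^sub>C x)"
      by (rule koszul_exact_of_onorm_power_less_1[OF assms(2) f_l])
    with l show False by (simp add: taylor_spectrum_def)
  qed
qed

end
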